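(* The group $\mathrm{Hol}(\mathbb C,0)$ satisfies property (ICP). Indeed it satisfies the following stronger property: let $f\in\mathrm{Hol}(\mathbb C,0)$, $f$ not an involution (i.e. $f\circ f\neq\mathrm{Id}$ as germs), and let $\gamma$ be a curve of class $C^1$, defined in a small neighborhood of $0$ in $\mathbb C$ and with $0\in\gamma$. Suppose that $\gamma$ is invariant under $f$. Then $\gamma\setminus\{0\}$ is real-analytic.
   Context: $\mathrm{Hol}(\mathbb C,0)$ is the group of germs at $0$ of holomorphic maps $f$ with $f(0)=0$, $f'(0)\neq 0$, regarded as a subgroup of $\mathrm{Diff}^\omega(\mathbb R^2,0)$, the group of germs at $0$ of real-analytic maps of $\mathbb R^2\cong\mathbb C$ fixing $0$ with non-zero Jacobian determinant at $0$. A curve of class $C^k$ around $0$ is a closed $1$-dimensional $C^k$ submanifold $\lambda$ of an open neighborhood of $0$ in $\mathbb R^2$ such that $0\in\lambda$; it is invariant under a germ $g$ if $g(q)\in\lambda$ for any $q\in\lambda$ close enough to $0$. For such a curve, "$\lambda\setminus\{0\}$ is real-analytic" means that for any $p\in\lambda$, $p\neq 0$, there is a neighborhood $U$ of $p$ in $\mathbb R^2$ such that $\lambda\cap U$ is real-analytic. A subgroup $\mathcal G\leq\mathrm{Diff}^\omega(\mathbb R^2,0)$ satisfies (ICP), the invariant curve property, if for every $g\in\mathcal G$ with $g\circ g\neq\mathrm{Id}$ and for any curve $\lambda$ of class $C^\infty$ around $0$ which is invariant under $g$, $\lambda\setminus\{0\}$ is real-analytic.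
   Formalization: Real-analyticity of γ∖{0} (also in (ICP)) is asserted only in some neighborhood of 0: since invariance is required only near 0, the claim for all of γ fails, e.g. for z ↦ 2z and the real axis with a smooth non-analytic bump away from 0. *)

theory Defs
  imports "HOL-Analysis.Analysis" "HOL-Library.Extended_Nat" "HOL-Algebra.Group"
begin

text \<open>The plane is the type of complex numbers throughout, with real coordinates Re and Im.\<close>

section \<open>Regularity of maps of the plane\<close>

text \<open>\<open>fx\<close> and \<open>fy\<close> are the two partial derivatives.\<close>

fun Ck_on :: "nat \<Rightarrow> (complex \<Rightarrow> complex) \<Rightarrow> complex set \<Rightarrow> bool" where
  "Ck_on 0 f U \<longleftrightarrow> continuous_on U f"
| "Ck_on (Suc n) f U \<longleftrightarrow>
     (\<exists>fx fy. (\<forall>z\<in>U. (f has_derivative (\<lambda>h. Re h *\<^sub>R fx z + Im h *\<^sub>R fy z)) (at z)) \<and>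
              Ck_on n fx U \<and> Ck_on n fy U)"

definition class_C_on :: "enat \<Rightarrow> (complex \<Rightarrow> complex) \<Rightarrow> complex set \<Rightarrow> bool" where
  "class_C_on k f U \<longleftrightarrow> (\<forall>n. enat n \<le> k \<longrightarrow> Ck_on n f U)"

text \<open>Real-analyticity: a convergent double power series in the two real coordinates.
  The coefficients are complex because the values are points of the plane.\<close>

definition real_analytic_at :: "(complex \<Rightarrow> complex) \<Rightarrow> complex \<Rightarrow> bool" where
  "real_analytic_at f p \<longleftrightarrow>
     (\<exists>(a :: nat \<Rightarrow> nat \<Rightarrow> complex) r. r > 0 \<and>
        (\<forall>x y :: real. \<bar>x\<bar> < r \<longrightarrow> \<bar>y\<bar> < r \<longrightarrow>
           ((\<lambda>(i, j). (x ^ i * y ^ j) *\<^sub>R a i j) has_sum f (p + Complex x y)) UNIV))"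

definition real_analytic_on :: "(complex \<Rightarrow> complex) \<Rightarrow> complex set \<Rightarrow> bool" where
  "real_analytic_on f U \<longleftrightarrow> (\<forall>p\<in>U. real_analytic_at f p)"

definition jacobian_det :: "(complex \<Rightarrow> complex) \<Rightarrow> complex \<Rightarrow> real" where
  "jacobian_det f p =
     (let D = frechet_derivative f (at p)
      in Re (D 1) * Im (D \<i>) - Re (D \<i>) * Im (D 1))"

section \<open>Germs at the origin\<close>

text \<open>Germs at 0 of maps fixing 0 and continuous there; continuity makes composition of germs
  well defined. The relation is reflexive exactly on the admissible representatives.\<close>

definition germ_rel :: "(complex \<Rightarrow> complex) \<Rightarrow> (complex \<Rightarrow> complex) \<Rightarrow> bool" where
  "germ_rel f g \<longleftrightarrow> f 0 = 0 \<and> g 0 = 0 \<and> isCont f 0 \<and> isCont g 0 \<and>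
     (\<forall>\<^sub>F z in nhds 0. f z = g z)"

quotient_type germ = "complex \<Rightarrow> complex" / partial: germ_rel
proof (rule part_equivpI)
  show "\<exists>f. germ_rel f f"
    by (rule exI[of _ "\<lambda>z. z"]) (simp add: germ_rel_def)
  show "symp germ_rel"
    unfolding symp_def germ_rel_def by (blast intro: eventually_mono sym)
  show "transp germ_rel"
  proof (rule transpI)
    fix f g h assume fg: "germ_rel f g" and gh: "germ_rel g h"
    have "\<forall>\<^sub>F z in nhds 0. f z = h z"
      by (rule eventually_elim2[of "\<lambda>z. f z = g z" _ "\<lambda>z. g z = h z"])
        (use fg gh in \<open>simp_all add: germ_rel_def\<close>)
    then show "germ_rel f h"
      using fg gh by (simp add: germ_rel_def)
  qed
qed

lift_definition germ_id :: germ is "\<lambda>z. z"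
  by (simp add: germ_rel_def)

lift_definition germ_comp :: "germ \<Rightarrow> germ \<Rightarrow> germ" is "\<lambda>f g. f \<circ> g"
proof -
  fix f f' g g' :: "complex \<Rightarrow> complex"
  assume f: "germ_rel f f'" and g: "germ_rel g g'"
  have "filterlim g (nhds (g 0)) (nhds 0)"
    using g unfolding germ_rel_def isCont_def tendsto_at_iff_tendsto_nhds by blast
  then have lim: "filterlim g (nhds 0) (nhds 0)"
    using g by (simp add: germ_rel_def)
  have "\<forall>\<^sub>F w in nhds 0. f w = f' w"
    using f by (simp add: germ_rel_def)
  from eventually_compose_filterlim[OF this lim]
  have "\<forall>\<^sub>F z in nhds 0. f (g z) = f' (g z)" .
  moreover have "\<forall>\<^sub>F z in nhds 0. g z = g' z"
    using g by (simp add: germ_rel_def)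
  ultimately have "\<forall>\<^sub>F z in nhds 0. (f \<circ> g) z = (f' \<circ> g') z"
    by eventually_elim simp
  then show "germ_rel (f \<circ> g) (f' \<circ> g')"
    using f g isCont_o2[of 0 g f] isCont_o2[of 0 g' f'] by (simp add: germ_rel_def o_def)
qed

lemma real_analytic_at_cong:
  assumes "real_analytic_at f p" "\<forall>\<^sub>F z in nhds p. f z = g z"
  shows "real_analytic_at g p"
proof -
  obtain a r where r: "r > 0" and
    a: "\<And>x y :: real. \<bar>x\<bar> < r \<Longrightarrow> \<bar>y\<bar> < r \<Longrightarrow>
       ((\<lambda>(i, j). (x ^ i * y ^ j) *\<^sub>R (a i j :: complex)) has_sum f (p + Complex x y)) UNIV"
    using assms(1) unfolding real_analytic_at_def by blast
  obtain e where e: "e > 0" and eq: "\<And>z. dist z p < e \<Longrightarrow> f z = g z"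
    using assms(2) unfolding eventually_nhds_metric by blast
  have "((\<lambda>(i, j). (x ^ i * y ^ j) *\<^sub>R a i j) has_sum g (p + Complex x y)) UNIV"
    if "\<bar>x\<bar> < min r (e/2)" "\<bar>y\<bar> < min r (e/2)" for x y
  proof -
    have "cmod (Complex x y) \<le> \<bar>x\<bar> + \<bar>y\<bar>"
      using cmod_le[of "Complex x y"] by simp
    also have "\<dots> < e" using that by simp
    finally have "f (p + Complex x y) = g (p + Complex x y)"
      by (intro eq) (simp add: dist_norm)
    then show ?thesis using a[of x y] that by simp
  qed
  then show ?thesis
    unfolding real_analytic_at_def using r e
    by (intro exI[of _ a] exI[of _ "min r (e/2)"]) auto
qed

lemma frechet_derivative_cong_nhds:
  assumes "\<forall>\<^sub>F z in nhds p. f z = g z"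
  shows "frechet_derivative f (at p) = frechet_derivative g (at p)"
proof -
  have *: "(v has_derivative D) (at p)"
    if u: "(u has_derivative D) (at p)" and ev: "\<forall>\<^sub>F z in nhds p. u z = v z"
    for u v :: "'a \<Rightarrow> 'b" and D
  proof (rule has_derivative_transform_eventually[OF u])
    show "\<forall>\<^sub>F z in at p. u z = v z"
      using ev unfolding eventually_at_filter by (rule eventually_mono) simp
    show "u p = v p"
      using ev by (rule eventually_nhds_x_imp_x)
  qed simp
  have "\<forall>\<^sub>F z in nhds p. g z = f z"
    using assms by (rule eventually_mono) (rule sym)
  then have "(f has_derivative D) (at p) \<longleftrightarrow> (g has_derivative D) (at p)" for D
    using *[of f D g] *[of g D f] assms by blast
  then show ?thesis unfolding frechet_derivative_def by simp
qed

lift_definition real_analytic_diffeo_germ :: "germ \<Rightarrow> bool" is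
  "\<lambda>f. real_analytic_at f 0 \<and> jacobian_det f 0 \<noteq> 0"
proof -
  fix f g :: "complex \<Rightarrow> complex"
  assume "germ_rel f g"
  then have ev: "\<forall>\<^sub>F z in nhds 0. f z = g z"
    unfolding germ_rel_def by blast
  then have ev': "\<forall>\<^sub>F z in nhds 0. g z = f z"
    by (rule eventually_mono) (rule sym)
  show "(real_analytic_at f 0 \<and> jacobian_det f 0 \<noteq> 0) =
      (real_analytic_at g 0 \<and> jacobian_det g 0 \<noteq> 0)"
    using real_analytic_at_cong[OF _ ev] real_analytic_at_cong[OF _ ev']
      frechet_derivative_cong_nhds[OF ev] unfolding jacobian_det_def by metis
qed

lemma analytic_on_singleton_cong:
  assumes "f analytic_on {p}" "\<forall>\<^sub>F z in nhds p. f z = g z"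
  shows "g analytic_on {p}"
proof -
  obtain d where d: "d > 0" "f holomorphic_on ball p d"
    using assms(1) unfolding analytic_on_def by blast
  obtain e where e: "e > 0" "\<And>z. dist z p < e \<Longrightarrow> f z = g z"
    using assms(2) unfolding eventually_nhds_metric by blast
  have "f holomorphic_on ball p (min d e)"
    using d(2) by (rule holomorphic_on_subset) auto
  then have "g holomorphic_on ball p (min d e)"
    by (rule holomorphic_transform) (simp add: e(2) dist_commute)
  then show ?thesis
    unfolding analytic_on_def using d(1) e(1) by (auto intro!: exI[of _ "min d e"])
qed

lift_definition holomorphic_germ :: "germ \<Rightarrow> bool" is
  "\<lambda>f. f analytic_on {0} \<and> deriv f 0 \<noteq> 0"
proof -
  fix f g :: "complex \<Rightarrow> complex"
  assume "germ_rel f g"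
  then have ev: "\<forall>\<^sub>F z in nhds 0. f z = g z"
    unfolding germ_rel_def by blast
  then have ev': "\<forall>\<^sub>F z in nhds 0. g z = f z"
    by (rule eventually_mono) (rule sym)
  show "(f analytic_on {0} \<and> deriv f 0 \<noteq> 0) = (g analytic_on {0} \<and> deriv g 0 \<noteq> 0)"
    using analytic_on_singleton_cong[OF _ ev] analytic_on_singleton_cong[OF _ ev']
      deriv_cong_ev[OF ev refl] by auto
qed

definition Diff_omega :: "germ monoid" where
  "Diff_omega = \<lparr>carrier = {g. real_analytic_diffeo_germ g}, mult = germ_comp, one = germ_id\<rparr>"

definition Hol0 :: "germ set" where
  "Hol0 = {g. holomorphic_germ g}"

section \<open>Curves\<close>

text \<open>One-dimensional submanifolds of the plane, by straightening charts: near each of its points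
  the set is carried onto a piece of the real axis by a diffeomorphism of the regularity
  \<open>R\<close> between open sets.\<close>

definition submanifold1 ::
  "((complex \<Rightarrow> complex) \<Rightarrow> complex set \<Rightarrow> bool) \<Rightarrow> complex set \<Rightarrow> bool" where
  "submanifold1 R S \<longleftrightarrow>
     (\<forall>p\<in>S. \<exists>U V \<phi> \<psi>. open U \<and> p \<in> U \<and> open V \<and> homeomorphism U V \<phi> \<psi> \<and>
        R \<phi> U \<and> R \<psi> V \<and> \<phi> ` (S \<inter> U) = {w \<in> V. Im w = 0})"

definition curve_around_0 :: "enat \<Rightarrow> complex set \<Rightarrow> bool" where
  "curve_around_0 k \<gamma> \<longleftrightarrow>
     (\<exists>W. open W \<and> 0 \<in> W \<and> closedin (top_of_set W) \<gamma>) \<and> 0 \<in> \<gamma> \<and>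
     submanifold1 (class_C_on k) \<gamma>"

lift_definition invariant_curve :: "germ \<Rightarrow> complex set \<Rightarrow> bool" is
  "\<lambda>g \<gamma>. \<forall>\<^sub>F q in nhds 0. q \<in> \<gamma> \<longrightarrow> g q \<in> \<gamma>"
proof (rule ext)
  fix f g :: "complex \<Rightarrow> complex" and \<gamma>
  assume "germ_rel f g"
  then have "\<forall>\<^sub>F q in nhds 0. f q = g q"
    by (simp add: germ_rel_def)
  then have "\<forall>\<^sub>F q in nhds 0. (q \<in> \<gamma> \<longrightarrow> f q \<in> \<gamma>) = (q \<in> \<gamma> \<longrightarrow> g q \<in> \<gamma>)"
    by (rule eventually_mono) simp
  then show "(\<forall>\<^sub>F q in nhds 0. q \<in> \<gamma> \<longrightarrow> f q \<in> \<gamma>) = (\<forall>\<^sub>F q in nhds 0. q \<in> \<gamma> \<longrightarrow> g q \<in> \<gamma>)"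
    by (rule eventually_subst)
qed

definition real_analytic_off_0 :: "complex set \<Rightarrow> bool" where
  "real_analytic_off_0 \<gamma> \<longleftrightarrow>
     (\<forall>p\<in>\<gamma>. p \<noteq> 0 \<longrightarrow> (\<exists>U. open U \<and> p \<in> U \<and> submanifold1 real_analytic_on (\<gamma> \<inter> U)))"

text \<open>Invariance restricts a curve only near 0, so a curve around 0 is meant up to shrinking the
  neighbourhood in which it lies. Without the shrinking the property would fail trivially: the real
  axis with a smooth non-analytic bump added away from 0 is still invariant under the germ of
  \<open>z \<mapsto> 2 z\<close>.\<close>

definition germ_real_analytic_off_0 :: "complex set \<Rightarrow> bool" where
  "germ_real_analytic_off_0 \<gamma> \<longleftrightarrow> (\<exists>N. open N \<and> 0 \<in> N \<and> real_analytic_off_0 (\<gamma> \<inter> N))"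

definition ICP :: "germ set \<Rightarrow> bool" where
  "ICP G \<longleftrightarrow> subgroup G Diff_omega \<and>
     (\<forall>g\<in>G. germ_comp g g \<noteq> germ_id \<longrightarrow>
        (\<forall>\<gamma>. curve_around_0 \<infinity> \<gamma> \<longrightarrow> invariant_curve g \<gamma> \<longrightarrow> germ_real_analytic_off_0 \<gamma>))"

end

theory Submission
  imports Defs "HOL-Complex_Analysis.Complex_Analysis"
begin

text \<open>Since the curve is invariant, the multiplier \<open>f'(0)\<close> preserves its tangent at \<open>0\<close>. Replacing \<open>f\<close> by
  \<open>f \<circ> f\<close> if the multiplier has modulus \<open>1\<close> (it is then \<open>\<plusminus>1\<close>), and by its inverse where necessary, every
  point \<open>q \<noteq> 0\<close> of the curve near \<open>0\<close> lies in an open set \<open>P\<close> which \<open>g = f\<^sup>\<plusminus>\<^sup>1, f\<^sup>\<plusminus>\<^sup>2\<close> maps injectively into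
  itself and on which its iterates tend to \<open>0\<close>: a disc in the hyperbolic case, an attracting petal in the
  parabolic one. The normalised iterates \<open>(g\<^sup>n(z) - g\<^sup>n(q)) / (g\<^sup>n)'(q)\<close> are univalent, hence form a normal
  family, and a limit \<open>\<Phi>\<close> is a local biholomorphism (a linearising or Fatou coordinate). For \<open>z\<close> on the
  curve, \<open>g\<^sup>n(z) - g\<^sup>n(q)\<close> is a chord between points of the curve tending to \<open>0\<close>, and its direction tends to
  that of the tangent at \<open>0\<close> because the curve is \<open>C\<^sup>1\<close> there. So \<open>\<Phi>\<close> maps the curve near \<open>q\<close> into a
  straight line, and onto a neighbourhood of \<open>0\<close> in that line by invariance of domain.\<close>

section \<open>Holomorphic functions are real-analytic\<close>

text \<open>Each (x + i y)^n is expanded by the binomial theorem. The absolute values of the terms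
  of degree n add up to |c n| (|x| + |y|)^n, so convergence at |x| + |y|, rather than at |x + i y|,
  is what permits rearranging into an unordered double sum.\<close>

lemma has_sum_double_power_series:
  fixes c :: "nat \<Rightarrow> complex" and x y :: real
  assumes c: "(\<lambda>n. c n * (Complex x y) ^ n) sums S"
    and abs: "summable (\<lambda>n. norm (c n) * (\<bar>x\<bar> + \<bar>y\<bar>) ^ n)"
  shows "((\<lambda>(i, j). (x ^ i * y ^ j) *\<^sub>R (c (i + j) * of_nat ((i + j) choose i) * \<i> ^ j)) has_sum S) UNIV"
proof -
  define f where "f = (\<lambda>(n, k). (x ^ k * y ^ (n - k)) *\<^sub>R (c n * of_nat (n choose k) * \<i> ^ (n - k)))"
  let ?S = "SIGMA n:UNIV. {..n::nat}"
  have row: "((\<lambda>k. f (n, k)) has_sum c n * (Complex x y) ^ n) {..n}" for n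
  proof -
    have "(Complex x y) ^ n = (of_real x + of_real y * \<i>) ^ n"
      by (simp add: Complex_eq mult.commute)
    also have "\<dots> = (\<Sum>k\<le>n. of_nat (n choose k) * of_real x ^ k * (of_real y * \<i>) ^ (n - k))"
      by (rule binomial_ring)
    finally have "c n * (Complex x y) ^ n = (\<Sum>k\<le>n. f (n, k))"
      by (simp add: f_def sum_distrib_left scaleR_conv_of_real power_mult_distrib mult_ac)
    then show ?thesis
      by (simp add: has_sum_finite_iff)
  qed
  have row_norm: "((\<lambda>k. norm (f (n, k))) has_sum norm (c n) * (\<bar>x\<bar> + \<bar>y\<bar>) ^ n) {..n}" for n
  proof -
    have "(\<bar>x\<bar> + \<bar>y\<bar>) ^ n = (\<Sum>k\<le>n. of_nat (n choose k) * \<bar>x\<bar> ^ k * \<bar>y\<bar> ^ (n - k))"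
      by (rule binomial_ring)
    then have "norm (c n) * (\<bar>x\<bar> + \<bar>y\<bar>) ^ n = (\<Sum>k\<le>n. norm (f (n, k)))"
      by (simp add: f_def sum_distrib_left norm_mult norm_power abs_mult power_abs mult_ac)
    then show ?thesis
      by (simp add: has_sum_finite_iff)
  qed
  have "(\<lambda>p. norm (f p)) summable_on ?S"
  proof (rule summable_on_SigmaI[OF row_norm])
    show "(\<lambda>n. norm (c n) * (\<bar>x\<bar> + \<bar>y\<bar>) ^ n) summable_on UNIV"
      by (rule norm_summable_imp_summable_on) (use abs in \<open>simp add: abs_mult\<close>)
  qed auto
  then have summ: "f summable_on ?S"
    by (rule abs_summable_summable)
  have "summable (\<lambda>n. norm (c n * (Complex x y) ^ n))"
  proof (rule summable_comparison_test'[OF abs])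
    show "norm (norm (c n * (Complex x y) ^ n)) \<le> norm (c n) * (\<bar>x\<bar> + \<bar>y\<bar>) ^ n" for n
      using cmod_le[of "Complex x y"]
      by (auto simp: norm_mult norm_power intro!: mult_left_mono power_mono)
  qed
  then have "((\<lambda>n. c n * (Complex x y) ^ n) has_sum S) UNIV"
    using c by (rule norm_summable_imp_has_sum)
  from has_sum_SigmaI[OF row this summ] have "(f has_sum S) ?S" .
  moreover have "bij_betw (\<lambda>(i, j). (i + j, i)) (UNIV :: (nat \<times> nat) set) ?S"
    by (rule bij_betwI[where g = "\<lambda>(n, k). (k, n - k)"]) auto
  ultimately have "((\<lambda>p. f (case p of (i, j) \<Rightarrow> (i + j, i))) has_sum S) UNIV"
    by (subst has_sum_reindex_bij_betw)
  moreover have "(\<lambda>p. f (case p of (i, j) \<Rightarrow> (i + j, i))) =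
      (\<lambda>(i, j). (x ^ i * y ^ j) *\<^sub>R (c (i + j) * of_nat ((i + j) choose i) * \<i> ^ j))"
    by (auto simp: f_def)
  ultimately show ?thesis
    by simp
qed

lemma analytic_imp_real_analytic_at:
  assumes "f analytic_on {p}"
  shows "real_analytic_at f p"
proof -
  obtain e where e: "e > 0" "f holomorphic_on ball p e"
    using assms by (auto simp: analytic_at_ball)
  define c where "c n = (deriv ^^ n) f p / fact n" for n
  have ser: "(\<lambda>n. c n * w ^ n) sums f (p + w)" if "norm w < e" for w
    using holomorphic_power_series[OF e(2), of "p + w"] that by (simp add: c_def dist_norm)
  show ?thesis
    unfolding real_analytic_at_def
  proof (intro exI conjI allI impI)
    \<comment> \<open>This keeps |x| + |y| below e / 2, a point where the power series still
      converges.\<close>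
    show "e / 4 > 0" using e by simp
    fix x y :: real
    assume xy: "\<bar>x\<bar> < e / 4" "\<bar>y\<bar> < e / 4"
    have "norm (Complex x y) < e"
      using cmod_le[of "Complex x y"] xy by simp
    then have s: "(\<lambda>n. c n * (Complex x y) ^ n) sums f (p + Complex x y)"
      by (rule ser)
    have "summable (\<lambda>n. c n * (of_real (e / 2)) ^ n)"
      using ser[of "of_real (e / 2)"] e(1) by (auto simp: sums_iff)
    then have "summable (\<lambda>n. norm (c n * (of_real (\<bar>x\<bar> + \<bar>y\<bar>)) ^ n))"
      by (rule powser_insidea) (use xy e in \<open>simp only: norm_of_real; simp\<close>)
    then have "summable (\<lambda>n. norm (c n) * (\<bar>x\<bar> + \<bar>y\<bar>) ^ n)"
      by (simp only: norm_mult norm_power norm_of_real abs_idempotent) simp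
    from has_sum_double_power_series[OF s this]
    show "((\<lambda>(i, j). (x ^ i * y ^ j) *\<^sub>R (c (i + j) * of_nat ((i + j) choose i) * \<i> ^ j))
        has_sum f (p + Complex x y)) UNIV" .
  qed
qed

section \<open>The group of holomorphic germs\<close>

text \<open>Serves twice: for inverses in the group of germs, and for trading expansion for
  contraction in the dynamical arguments.\<close>

lemma analytic_local_inverse:
  assumes "f analytic_on {0}" "f 0 = 0" "deriv f 0 \<noteq> 0"
  obtains g where "g analytic_on {0}" "g 0 = 0" "deriv f 0 * deriv g 0 = 1"
    "\<forall>\<^sub>F z in nhds 0. g (f z) = z" "\<forall>\<^sub>F z in nhds 0. f (g z) = z"
proof -
  obtain e where e: "e > 0" "f holomorphic_on ball 0 e"
    using assms(1) by (auto simp: analytic_at_ball)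
  have "0 \<in> ball (0::complex) e" using e(1) by simp
  from has_complex_derivative_locally_invertible[OF e(2) this open_ball assms(3)]
  obtain r where r: "r > 0" "ball (0::complex) r \<subseteq> ball 0 e" "open (f ` ball 0 r)" "inj_on f (ball 0 r)"
    by metis
  have hol: "f holomorphic_on ball 0 r" using e(2) r(2) holomorphic_on_subset by blast
  obtain g where g: "g holomorphic_on f ` ball 0 r" "\<And>z. z \<in> ball 0 r \<Longrightarrow> deriv f z * deriv g (f z) = 1"
    "\<And>z. z \<in> ball 0 r \<Longrightarrow> g (f z) = z"
    using holomorphic_has_inverse[OF hol open_ball r(4)] by blast
  have zero: "0 \<in> ball (0::complex) r" using r(1) by simp
  show ?thesis
  proof (rule that[of g])
    show "g analytic_on {0}"
      using holomorphic_on_imp_analytic_at[OF g(1) r(3)] zero assms(2) by (metis imageI)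
    show "g 0 = 0" "deriv f 0 * deriv g 0 = 1"
      using g(2,3)[OF zero] assms(2) by auto
    have "\<forall>\<^sub>F z in nhds 0. z \<in> ball (0::complex) r"
      using zero by (intro eventually_nhds_in_open) auto
    then show "\<forall>\<^sub>F z in nhds 0. g (f z) = z"
      by (rule eventually_mono) (rule g(3))
    have "\<forall>\<^sub>F z in nhds 0. z \<in> f ` ball 0 r"
      using r(3) zero assms(2) by (intro eventually_nhds_in_open) (metis imageI)+
    then show "\<forall>\<^sub>F z in nhds 0. f (g z) = z"
      by (rule eventually_mono) (use g(3) in auto)
  qed
qed

text \<open>The differential is multiplication by \<open>deriv f p\<close>, whose real determinant
  is the squared modulus. This is what places holomorphic germs inside
  \<open>Diff_omega\<close>.\<close>

lemma jacobian_det_analytic: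
  assumes "f analytic_on {p}"
  shows "jacobian_det f p = (norm (deriv f p))\<^sup>2"
proof -
  have "(f has_field_derivative deriv f p) (at p)"
    using assms by (simp add: DERIV_deriv_iff_field_differentiable analytic_on_imp_differentiable_at)
  then have "frechet_derivative f (at p) = (*) (deriv f p)"
    using frechet_derivative_at has_field_derivative_imp_has_derivative by metis
  then show ?thesis
    by (simp add: jacobian_det_def cmod_power2) (simp add: power2_eq_square)
qed

lemma germ_comp_assoc: "germ_comp (germ_comp a b) c = germ_comp a (germ_comp b c)"
proof transfer
  fix a b c assume r: "germ_rel a a" "germ_rel b b" "germ_rel c c"
  have "germ_rel ((a \<circ> b) \<circ> c) ((a \<circ> b) \<circ> c)"
    using r germ_comp.rsp unfolding rel_fun_def by blast
  then show "germ_rel ((a \<circ> b) \<circ> c) (a \<circ> (b \<circ> c))"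
    by (simp add: comp_assoc)
qed

lemma germ_comp_id: "germ_comp germ_id a = a" "germ_comp a germ_id = a"
  by (transfer, simp add: germ_rel_def o_def)+

lemma holomorphic_germ_id: "holomorphic_germ germ_id"
  by transfer (simp add: analytic_on_ident)

lemma holomorphic_germ_comp:
  assumes "holomorphic_germ a" "holomorphic_germ b"
  shows "holomorphic_germ (germ_comp a b)"
  using assms
proof transfer
  fix a b assume r: "germ_rel a a" "germ_rel b b" 
    and h: "a analytic_on {0} \<and> deriv a 0 \<noteq> 0" "b analytic_on {0} \<and> deriv b 0 \<noteq> 0"
  have b0: "b 0 = 0" using r by (simp add: germ_rel_def)
  have "(a \<circ> b) analytic_on {0}"
    using h b0 by (intro analytic_on_compose) auto
  moreover have "deriv (a \<circ> b) 0 = deriv a (b 0) * deriv b 0"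
    by (rule deriv_chain) (use h b0 in \<open>auto intro: analytic_on_imp_differentiable_at\<close>)
  ultimately show "(a \<circ> b) analytic_on {0} \<and> deriv (a \<circ> b) 0 \<noteq> 0"
    using h b0 by simp
qed

lemma holomorphic_germ_inverse:
  assumes "holomorphic_germ a"
  shows "\<exists>b. holomorphic_germ b \<and> germ_comp a b = germ_id \<and> germ_comp b a = germ_id"
  using assms
proof transfer
  fix a assume r: "germ_rel a a" and h: "a analytic_on {0} \<and> deriv a 0 \<noteq> 0"
  have a0: "a 0 = 0" and ca: "isCont a 0" using r by (auto simp: germ_rel_def)
  obtain g where g: "g analytic_on {0}" "g 0 = 0" "deriv a 0 * deriv g 0 = 1"
    "\<forall>\<^sub>F z in nhds 0. g (a z) = z" "\<forall>\<^sub>F z in nhds 0. a (g z) = z"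
    using analytic_local_inverse[of a] a0 h by auto
  have cg: "isCont g 0" using g(1) by (rule analytic_at_imp_isCont)
  have "isCont (a \<circ> g) 0" "isCont (g \<circ> a) 0"
    using continuous_at_compose[of 0 g a] continuous_at_compose[of 0 a g] ca cg a0 g(2) by simp_all
  then have "germ_rel g g \<and> (g analytic_on {0} \<and> deriv g 0 \<noteq> 0) \<and> germ_rel (a \<circ> g) (\<lambda>z. z) \<and> germ_rel (g \<circ> a) (\<lambda>z. z)"
    using g a0 cg by (auto simp: germ_rel_def)
  then show "\<exists>b\<in>{x. germ_rel x x}. (b analytic_on {0} \<and> deriv b 0 \<noteq> 0) \<and>
      germ_rel (a \<circ> b) (\<lambda>z. z) \<and> germ_rel (b \<circ> a) (\<lambda>z. z)"
    by blast
qed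

lemma holomorphic_germ_imp_real_analytic_diffeo:
  "holomorphic_germ a \<Longrightarrow> real_analytic_diffeo_germ a"
  by transfer (simp add: analytic_imp_real_analytic_at jacobian_det_analytic)

lemma subgroup_Hol0: "subgroup Hol0 Diff_omega"
proof
  show "Hol0 \<subseteq> carrier Diff_omega"
    by (auto simp: Hol0_def Diff_omega_def holomorphic_germ_imp_real_analytic_diffeo)
  show "x \<otimes>\<^bsub>Diff_omega\<^esub> y \<in> Hol0" if "x \<in> Hol0" "y \<in> Hol0" for x y
    using that by (simp add: Hol0_def Diff_omega_def holomorphic_germ_comp)
  show "\<one>\<^bsub>Diff_omega\<^esub> \<in> Hol0"
    by (simp add: Hol0_def Diff_omega_def holomorphic_germ_id)
  fix x assume "x \<in> Hol0"
  then obtain y where y: "holomorphic_germ y" "germ_comp x y = germ_id" "germ_comp y x = germ_id"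
    using holomorphic_germ_inverse by (auto simp: Hol0_def)
  \<comment> \<open>The inverse is a definite description, so uniqueness has to be shown: composing
    with \<open>y\<close> on the left turns a right inverse of \<open>x\<close> into
    \<open>y\<close>.\<close>
  have "inv\<^bsub>Diff_omega\<^esub> x = y"
    unfolding m_inv_def
  proof (rule the_equality)
    show "y \<in> carrier Diff_omega \<and> x \<otimes>\<^bsub>Diff_omega\<^esub> y = \<one>\<^bsub>Diff_omega\<^esub> \<and> y \<otimes>\<^bsub>Diff_omega\<^esub> x = \<one>\<^bsub>Diff_omega\<^esub>"
      using y by (simp add: Diff_omega_def holomorphic_germ_imp_real_analytic_diffeo)
    fix z assume "z \<in> carrier Diff_omega \<and> x \<otimes>\<^bsub>Diff_omega\<^esub> z = \<one>\<^bsub>Diff_omega\<^esub> \<and> z \<otimes>\<^bsub>Diff_omega\<^esub> x = \<one>\<^bsub>Diff_omega\<^esub>"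
    then have "germ_comp x z = germ_id" by (simp add: Diff_omega_def)
    then show "z = y"
      using y(3) germ_comp_assoc[of y x z] by (simp add: germ_comp_id)
  qed
  then show "inv\<^bsub>Diff_omega\<^esub> x \<in> Hol0" using y by (simp add: Hol0_def)
qed

section \<open>Straightening charts and chords\<close>

text \<open>The charts of \<open>submanifold1\<close> stripped of regularity: the topological
  arguments work with these alone, and smoothness is added where chords are compared.\<close>

definition straightens :: "(complex \<Rightarrow> complex) \<Rightarrow> (complex \<Rightarrow> complex) \<Rightarrow> complex set \<Rightarrow> complex set \<Rightarrow> complex set \<Rightarrow> bool" where
  "straightens \<phi> \<psi> U V \<gamma> \<longleftrightarrow> open U \<and> open V \<and> homeomorphism U V \<phi> \<psi> \<and> \<phi> ` (\<gamma> \<inter> U) = {w \<in> V. Im w = 0}"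

lemma straightens_iff:
  assumes "straightens \<phi> \<psi> U V \<gamma>" "q \<in> U"
  shows "q \<in> \<gamma> \<longleftrightarrow> Im (\<phi> q) = 0"
proof -
  have hom: "homeomorphism U V \<phi> \<psi>" and im: "\<phi> ` (\<gamma> \<inter> U) = {w \<in> V. Im w = 0}"
    using assms by (auto simp: straightens_def)
  have "\<phi> q \<in> V"
    using hom assms(2) unfolding homeomorphism_def by blast
  show ?thesis
  proof
    assume "q \<in> \<gamma>"
    then show "Im (\<phi> q) = 0" using im assms(2) by blast
  next
    assume "Im (\<phi> q) = 0"
    then have "\<phi> q \<in> \<phi> ` (\<gamma> \<inter> U)" using im \<open>\<phi> q \<in> V\<close> by blast
    then obtain q' where "q' \<in> \<gamma>" "q' \<in> U" "\<phi> q = \<phi> q'" by blast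
    then show "q \<in> \<gamma>"
      using homeomorphism_apply1[OF hom] assms(2) by metis
  qed
qed

text \<open>Read along the parametrisation \<open>\<psi>\<close> of the curve, \<open>h\<close> is a
  continuous injective real function on an interval, so its image is open by invariance of domain.
  This is the tool for showing that an image of the curve locally fills the real axis and does not
  merely lie in it.\<close>

lemma straightens_real_nbhd:
  assumes st: "straightens \<phi> \<psi> U V \<gamma>" and p: "p \<in> U" "p \<in> \<gamma>" and B: "open B" "p \<in> B"
    and cont: "continuous_on (\<gamma> \<inter> B) h" and inj: "inj_on h (\<gamma> \<inter> B)"
    and real: "\<And>q. q \<in> \<gamma> \<inter> B \<Longrightarrow> Im (h q) = 0"
  obtains \<delta> where "\<delta> > 0" "\<And>w. Im w = 0 \<Longrightarrow> norm (w - h p) < \<delta> \<Longrightarrow> w \<in> h ` (\<gamma> \<inter> B)"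
proof -
  have hom: "homeomorphism U V \<phi> \<psi>" and op: "open U" "open V" and im: "\<phi> ` (\<gamma> \<inter> U) = {w \<in> V. Im w = 0}"
    using st by (auto simp: straightens_def)
  have c\<psi>: "continuous_on V \<psi>" and pV: "\<phi> p \<in> V" and \<psi>\<phi>: "\<psi> (\<phi> p) = p"
    using hom p unfolding homeomorphism_def by auto
  have imp: "Im (\<phi> p) = 0" using straightens_iff[OF st] p by blast
  have "open (\<psi> -` B \<inter> V)"
    using continuous_on_open_vimage[OF op(2)] c\<psi> B(1) by blast
  moreover have "\<phi> p \<in> \<psi> -` B \<inter> V" using pV \<psi>\<phi> B by simp
  ultimately obtain e where e: "e > 0" "ball (\<phi> p) e \<subseteq> \<psi> -` B \<inter> V"
    using open_contains_ball by blast
  let ?I = "{Re (\<phi> p) - e <..< Re (\<phi> p) + e}"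
  have inball: "complex_of_real s \<in> ball (\<phi> p) e" if "s \<in> ?I" for s
  proof -
    have "\<phi> p = of_real (Re (\<phi> p))" using imp by (simp add: complex_eq_iff)
    then have "dist (\<phi> p) (of_real s) = \<bar>Re (\<phi> p) - s\<bar>"
      by (metis dist_of_real dist_real_def)
    then show ?thesis using that by auto
  qed
  have arc: "\<psi> (of_real s) \<in> \<gamma> \<inter> B" if "s \<in> ?I" for s
  proof -
    have s: "complex_of_real s \<in> \<psi> -` B \<inter> V" using inball[OF that] e by blast
    then have "complex_of_real s \<in> \<phi> ` (\<gamma> \<inter> U)" using im by simp
    then show ?thesis using s homeomorphism_apply1[OF hom] by force
  qed
  define k where "k s = Re (h (\<psi> (of_real s)))" for s :: real
  have cont': "continuous_on ?I k"
    unfolding k_def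
  proof (intro continuous_on_Re continuous_on_compose2[OF cont] continuous_on_compose2[OF c\<psi>])
    show "continuous_on ?I (\<lambda>s. complex_of_real s)" by (intro continuous_intros)
    show "complex_of_real ` ?I \<subseteq> V" using inball e by blast
    show "(\<lambda>s. \<psi> (of_real s)) ` ?I \<subseteq> \<gamma> \<inter> B" using arc by blast
  qed
  have inj': "inj_on k ?I"
  proof (rule inj_onI)
    fix s t assume st: "s \<in> ?I" "t \<in> ?I" "k s = k t"
    have "h (\<psi> (of_real s)) = h (\<psi> (of_real t))"
      using st real arc by (intro complex_eqI) (auto simp: k_def)
    then have "\<psi> (of_real s) = \<psi> (of_real t)"
      using inj arc st by (meson inj_onD)
    moreover have "\<phi> (\<psi> (of_real u)) = of_real u" if "u \<in> ?I" for u
      using homeomorphism_apply2[OF hom] inball[OF that] e by blast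
    ultimately show "s = t"
      using st by (metis of_real_eq_iff)
  qed
  have "open (k ` ?I)"
    by (rule invariance_of_domain[OF cont' _ inj']) simp
  moreover have "k (Re (\<phi> p)) \<in> k ` ?I" using e by auto
  ultimately obtain \<delta> where \<delta>: "\<delta> > 0" "ball (k (Re (\<phi> p))) \<delta> \<subseteq> k ` ?I"
    using open_contains_ball by blast
  have kp: "k (Re (\<phi> p)) = Re (h p)"
    using imp \<psi>\<phi> by (simp add: k_def of_real_Re complex_is_Real_iff)
  show ?thesis
  proof (rule that[OF \<delta>(1)])
    fix w :: complex assume w: "Im w = 0" "norm (w - h p) < \<delta>"
    have "\<bar>Re w - Re (h p)\<bar> < \<delta>" using abs_Re_le_cmod[of "w - h p"] w by simp
    then have "Re w \<in> ball (k (Re (\<phi> p))) \<delta>" by (simp add: kp dist_real_def abs_minus_commute)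
    then obtain s where s: "s \<in> ?I" "Re w = k s" using \<delta> by blast
    then have "w = h (\<psi> (of_real s))"
      using w real arc by (intro complex_eqI) (auto simp: k_def)
    then show "w \<in> h ` (\<gamma> \<inter> B)" using arc s by blast
  qed
qed

text \<open>With \<open>\<phi>\<close> itself as the injective map, real values close to
  \<open>\<phi> p\<close> but different from it are attained on the curve. This supplies a second
  reference point on the curve near \<open>q\<close>, and a nontrivial limit along the curve at
  0.\<close>

lemma straightens_islimpt:
  assumes st: "straightens \<phi> \<psi> U V \<gamma>" and p: "p \<in> U" "p \<in> \<gamma>"
  shows "p islimpt \<gamma>"
  unfolding islimpt_def
proof (intro allI impI)
  fix T :: "complex set" assume T: "p \<in> T" "open T"
  have opU: "open U" and hom: "homeomorphism U V \<phi> \<psi>"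
    using st by (auto simp: straightens_def)
  have op: "open (U \<inter> T)" "p \<in> U \<inter> T" using opU p T by auto
  have cont: "continuous_on (\<gamma> \<inter> (U \<inter> T)) \<phi>"
    using hom by (meson continuous_on_subset homeomorphism_def inf_le1 inf_le2 order_trans)
  have inj: "inj_on \<phi> (\<gamma> \<inter> (U \<inter> T))"
    using homeomorphism_apply1[OF hom] by (intro inj_on_inverseI[of _ \<psi>]) auto
  obtain \<delta> where \<delta>: "\<delta> > 0" "\<And>w. Im w = 0 \<Longrightarrow> norm (w - \<phi> p) < \<delta> \<Longrightarrow> w \<in> \<phi> ` (\<gamma> \<inter> (U \<inter> T))"
    using straightens_real_nbhd[OF st p op cont inj] straightens_iff[OF st] by (metis IntD1 IntD2)
  have "\<phi> p + of_real (\<delta> / 2) \<in> \<phi> ` (\<gamma> \<inter> (U \<inter> T))"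
  proof (rule \<delta>(2))
    show "Im (\<phi> p + of_real (\<delta> / 2)) = 0" using straightens_iff[OF st p(1)] p(2) by simp
    show "norm (\<phi> p + of_real (\<delta> / 2) - \<phi> p) < \<delta>" using \<delta>(1) by simp
  qed
  then obtain y where "y \<in> \<gamma>" "y \<in> T" "\<phi> p + of_real (\<delta> / 2) = \<phi> y"
    by blast
  then show "\<exists>y\<in>\<gamma>. y \<in> T \<and> y \<noteq> p"
    using \<delta>(1) by (intro bexI[of _ y]) auto
qed

text \<open>The imaginary part of \<open>\<phi>\<close> vanishes on the curve and has differential h
  -> Im (w * h) at \<open>p\<close>. Continuity of the partial derivatives gives
  \<open>\<phi>\<close> minus its differential at \<open>p\<close> a small Lipschitz constant near
  \<open>p\<close>, so the estimate covers chords with both ends free, not only those starting at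
  \<open>p\<close>.\<close>

lemma C1_chord_direction:
  assumes st: "straightens \<phi> \<psi> U V \<gamma>" and p: "p \<in> U"
    and C1: "Ck_on 1 \<phi> U" "Ck_on 1 \<psi> V"
  obtains w where "w \<noteq> 0"
    "\<And>\<epsilon>. \<epsilon> > 0 \<Longrightarrow> \<exists>\<delta>>0. \<forall>a\<in>\<gamma> \<inter> ball p \<delta>. \<forall>b\<in>\<gamma> \<inter> ball p \<delta>.
       \<bar>Im (w * (a - b))\<bar> \<le> \<epsilon> * norm (w * (a - b))"
proof -
  have hom: "homeomorphism U V \<phi> \<psi>" and op: "open U" "open V"
    using st by (auto simp: straightens_def)
  have pV: "\<phi> p \<in> V" using hom p unfolding homeomorphism_def by blast
  obtain fx fy where d: "\<And>z. z \<in> U \<Longrightarrow> (\<phi> has_derivative (\<lambda>h. Re h *\<^sub>R fx z + Im h *\<^sub>R fy z)) (at z)"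
    and cont: "continuous_on U fx" "continuous_on U fy"
    using C1(1) by auto
  obtain D where D: "(\<psi> has_derivative D) (at (\<phi> p))"
    using C1(2) pV by auto
  define w where "w = Complex (Im (fy p)) (Im (fx p))"
  have w_eq: "Im (w * h) = Im (Re h *\<^sub>R fx p + Im h *\<^sub>R fy p)" for h
    by (simp add: w_def algebra_simps)
  \<comment> \<open>Otherwise the differential of \<open>\<phi>\<close> at \<open>p\<close> would
    take only real values, whereas that of \<open>\<phi> \<circ> \<psi>\<close>, the identity on
    \<open>V\<close>, takes the value i.\<close>
  have w: "w \<noteq> 0"
  proof
    assume "w = 0"
    have "(\<phi> has_derivative (\<lambda>h. Re h *\<^sub>R fx p + Im h *\<^sub>R fy p)) (at (\<psi> (\<phi> p)))"
      using d[OF p] homeomorphism_apply1[OF hom p] by simp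
    from has_derivative_compose[OF D this]
    have 1: "((\<lambda>v. \<phi> (\<psi> v)) has_derivative (\<lambda>h. Re (D h) *\<^sub>R fx p + Im (D h) *\<^sub>R fy p)) (at (\<phi> p))" .
    have "((\<lambda>v. v) has_derivative (\<lambda>h. Re (D h) *\<^sub>R fx p + Im (D h) *\<^sub>R fy p)) (at (\<phi> p))"
      by (rule has_derivative_transform_within_open[OF 1 op(2) pV]) (rule homeomorphism_apply2[OF hom])
    then have "(\<lambda>h. Re (D h) *\<^sub>R fx p + Im (D h) *\<^sub>R fy p) = (\<lambda>h. h)"
      using has_derivative_unique[OF has_derivative_ident] by metis
    then have "Re (D \<i>) *\<^sub>R fx p + Im (D \<i>) *\<^sub>R fy p = \<i>" by meson
    then have "Im (w * D \<i>) = 1" using w_eq[of "D \<i>"] by simp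
    with \<open>w = 0\<close> show False by simp
  qed
  show ?thesis
  proof (rule that[OF w])
    fix \<epsilon> :: real assume "\<epsilon> > 0"
    \<comment> \<open>With this choice the mean value bound 2 * \<eta> * norm (a - b) equals
      \<epsilon> * norm (w * (a - b)).\<close>
    define \<eta> where "\<eta> = \<epsilon> * norm w / 2"
    have \<eta>: "\<eta> > 0" using \<open>\<epsilon> > 0\<close> w by (simp add: \<eta>_def)
    have "isCont fx p" "isCont fy p"
      using cont op p by (auto simp: continuous_on_eq_continuous_at)
    then obtain d1 d2 where d12: "d1 > 0" "\<And>z. dist z p < d1 \<Longrightarrow> dist (fx z) (fx p) < \<eta>"
      "d2 > 0" "\<And>z. dist z p < d2 \<Longrightarrow> dist (fy z) (fy p) < \<eta>"
      using \<eta> unfolding continuous_at_eps_delta by metis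
    obtain d3 where d3: "d3 > 0" "ball p d3 \<subseteq> U" using op p open_contains_ball by blast
    define \<delta> where "\<delta> = min (min d1 d2) d3"
    have \<delta>: "\<delta> > 0" "ball p \<delta> \<subseteq> U" using d12 d3 by (auto simp: \<delta>_def)
    have "\<bar>Im (w * (a - b))\<bar> \<le> \<epsilon> * norm (w * (a - b))"
      if a: "a \<in> \<gamma> \<inter> ball p \<delta>" and b: "b \<in> \<gamma> \<inter> ball p \<delta>" for a b
    proof -
      define L where "L z h = Re h *\<^sub>R fx z + Im h *\<^sub>R fy z" for z h
      have "norm ((\<phi> a - L p a) - (\<phi> b - L p b)) \<le> (2 * \<eta>) * norm (a - b)"
      proof (rule differentiable_bound[where f' = "\<lambda>z h. L z h - L p h"])
        show "convex (ball p \<delta>)" by simp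
        fix z assume z: "z \<in> ball p \<delta>"
        have bl: "(L p has_derivative L p) (at z within ball p \<delta>)"
          unfolding L_def by (auto intro!: derivative_eq_intros)
        have "(\<phi> has_derivative L z) (at z within ball p \<delta>)"
          using d[of z] z \<delta> unfolding L_def[abs_def] by (meson has_derivative_at_withinI subsetD)
        from has_derivative_diff[OF this bl]
        show "((\<lambda>z. \<phi> z - L p z) has_derivative (\<lambda>h. L z h - L p h)) (at z within ball p \<delta>)" .
        show "onorm (\<lambda>h. L z h - L p h) \<le> 2 * \<eta>"
        proof (rule onorm_bound)
          show "0 \<le> 2 * \<eta>" using \<eta> by simp
          fix h
          have "L z h - L p h = Re h *\<^sub>R (fx z - fx p) + Im h *\<^sub>R (fy z - fy p)"
            by (simp add: L_def algebra_simps)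
          then have "norm (L z h - L p h) \<le> \<bar>Re h\<bar> * norm (fx z - fx p) + \<bar>Im h\<bar> * norm (fy z - fy p)"
            using norm_triangle_ineq[of "Re h *\<^sub>R (fx z - fx p)" "Im h *\<^sub>R (fy z - fy p)"] by simp
          also have "\<dots> \<le> norm h * \<eta> + norm h * \<eta>"
            using z d12(2)[of z] d12(4)[of z] abs_Re_le_cmod[of h] abs_Im_le_cmod[of h]
            by (intro add_mono mult_mono) (auto simp: \<delta>_def dist_norm norm_minus_commute)
          finally show "norm (L z h - L p h) \<le> 2 * \<eta> * norm h" by (simp add: algebra_simps)
        qed
      qed (use a b in auto)
      moreover have "Im (\<phi> a) = 0" "Im (\<phi> b) = 0"
        using straightens_iff[OF st] a b \<delta>(2) by auto
      then have "Im ((\<phi> a - L p a) - (\<phi> b - L p b)) = - Im (w * (a - b))"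
        unfolding w_eq by (simp add: L_def algebra_simps)
      ultimately have "\<bar>Im (w * (a - b))\<bar> \<le> (2 * \<eta>) * norm (a - b)"
        using abs_Im_le_cmod[of "(\<phi> a - L p a) - (\<phi> b - L p b)"] by linarith
      then show ?thesis by (simp add: \<eta>_def norm_mult mult_ac)
    qed
    then show "\<exists>\<delta>>0. \<forall>a\<in>\<gamma> \<inter> ball p \<delta>. \<forall>b\<in>\<gamma> \<inter> ball p \<delta>.
       \<bar>Im (w * (a - b))\<bar> \<le> \<epsilon> * norm (w * (a - b))"
      using \<delta>(1) by blast
  qed
qed

text \<open>Im (c / d) is Im (c * cnj d) / |d|^2, and each of the two products in the numerator
  contains one small imaginary part, hence the factor 2. Two chords nearly tangent to the curve thus
  have a nearly real quotient.\<close>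

lemma Im_divide_le:
  assumes "\<bar>Im c\<bar> \<le> \<epsilon> * norm c" "\<bar>Im d\<bar> \<le> \<epsilon> * norm d"
  shows "\<bar>Im (c / d)\<bar> \<le> 2 * \<epsilon> * norm (c / d)"
proof (cases "d = 0")
  case False
  have "\<bar>Im (c * cnj d)\<bar> \<le> \<bar>Im c\<bar> * \<bar>Re d\<bar> + \<bar>Re c\<bar> * \<bar>Im d\<bar>"
    by (simp add: abs_mult[symmetric])
  also have "\<dots> \<le> (\<epsilon> * norm c) * norm d + norm c * (\<epsilon> * norm d)"
    using assms abs_Re_le_cmod[of c] abs_Re_le_cmod[of d]
    by (intro add_mono mult_mono) (auto intro: order_trans[OF abs_ge_zero])
  finally have "\<bar>Im (c * cnj d)\<bar> \<le> 2 * \<epsilon> * norm c * norm d" by simp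
  moreover have "Im (c / d) = Im (c * cnj d) / (norm d)\<^sup>2"
    by (simp only: complex_div_cnj[of c d] Im_divide_of_real of_real_power[symmetric])
  ultimately have "\<bar>Im (c / d)\<bar> \<le> (2 * \<epsilon> * norm c * norm d) / (norm d)\<^sup>2"
    by (simp only: abs_divide abs_power2 divide_right_mono zero_le_power2)
  then show ?thesis
    using False by (simp add: norm_divide power2_eq_square)
qed simp

section \<open>Normality of univalent functions\<close>

text \<open>If the image contained the disc of radius 2, then z -> g (2 * z), with \<open>g\<close>
  the inverse of \<open>F\<close>, would be a self-map of the unit disc fixing 0 with derivative 2,
  against the Schwarz lemma.\<close>

lemma injective_normalized_omits_value:
  assumes hol: "F holomorphic_on ball 0 1" and inj: "inj_on F (ball 0 1)"
    and "F 0 = 0" "deriv F 0 = 1"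
  obtains c where "norm c < 2" "c \<notin> F ` ball 0 1"
proof (rule ccontr)
  assume "\<not> thesis"
  then have sub: "ball 0 2 \<subseteq> F ` ball 0 1" using that by force
  obtain g where g: "g holomorphic_on (F ` ball 0 1)"
    "\<And>z. z \<in> ball 0 1 \<Longrightarrow> deriv F z * deriv g (F z) = 1" "\<And>z. z \<in> ball 0 1 \<Longrightarrow> g (F z) = z"
    using holomorphic_has_inverse[OF hol open_ball inj] by blast
  have g0: "g 0 = 0" "deriv g 0 = 1"
    using g(2)[of 0] g(3)[of 0] assms by auto
  have gd: "g field_differentiable at (2 * z)" if "norm z < 1" for z
    using g(1) sub that by (intro holomorphic_on_imp_differentiable_at[of g "ball 0 2"])
      (auto intro: holomorphic_on_subset simp: norm_mult)
  have der: "((\<lambda>z. g (2 * z)) has_field_derivative deriv g (2 * z) * 2) (at z)" if "norm z < 1" for z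
    using gd[OF that] by (intro DERIV_chain2) (auto intro!: derivative_eq_intros simp: DERIV_deriv_iff_field_differentiable)
  have "norm (deriv (\<lambda>z. g (2 * z)) 0) \<le> 1"
  proof (rule Schwarz_Lemma(2)[of _ 0])
    show "(\<lambda>z. g (2 * z)) holomorphic_on ball 0 1"
      using der by (intro holomorphic_onI) (auto simp: field_differentiable_def intro: DERIV_subset)
    show "norm (g (2 * z)) < 1" if "norm z < 1" for z
    proof -
      have "2 * z \<in> F ` ball 0 1" using sub that by (auto simp: norm_mult)
      then show ?thesis using g(3) by auto
    qed
  qed (use g0 in auto)
  moreover have "deriv (\<lambda>z. g (2 * z)) 0 = 2"
    using DERIV_imp_deriv[OF der[of 0]] g0 by simp
  ultimately show False by simp
qed

text \<open>A holomorphic square root \<open>H\<close> of \<open>1 - F / c\<close>, where \<open>c\<close> is an omitted value, omits the two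
  values \<open>0\<close> and \<open>- H 0\<close>, so Schottky's theorem applies to \<open>- H / H 0\<close>.\<close>

lemma injective_normalized_bounded:
  obtains M where "\<And>F z. F holomorphic_on ball 0 1 \<Longrightarrow> inj_on F (ball 0 1) \<Longrightarrow> F 0 = 0 \<Longrightarrow>
     deriv F 0 = 1 \<Longrightarrow> norm z < 1 / 2 \<Longrightarrow> norm (F z) \<le> M"
proof -
  define B :: real where "B = exp (pi * exp (pi * (2 + 2 * 1 + 12 * (2/3) / (1 - 2/3))))"
  show ?thesis
  proof (rule that[of "2 * (1 + B\<^sup>2)"])
    fix F z
    assume hol: "F holomorphic_on ball 0 1" and inj: "inj_on F (ball 0 1)"
      and F: "F 0 = 0" "deriv F 0 = 1" and z: "norm (z::complex) < 1 / 2"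
    obtain c where c: "norm c < 2" "c \<notin> F ` ball 0 1"
      using injective_normalized_omits_value[OF hol inj F] by blast
    have c0: "c \<noteq> 0" using c(2) F(1) by (metis centre_in_ball image_eqI zero_less_one)
    have "(\<lambda>z. 1 - F z / c) holomorphic_on ball 0 1"
      by (intro holomorphic_intros hol) (use c0 in auto)
    moreover have "1 - F z / c \<noteq> 0" if "z \<in> ball 0 1" for z
      using c c0 that by (auto simp: field_simps)
    moreover have "contractible (ball 0 1 :: complex set)"
      by (simp add: convex_imp_contractible)
    ultimately obtain H where H: "H holomorphic_on ball 0 1" "\<And>z. z \<in> ball 0 1 \<Longrightarrow> 1 - F z / c = H z ^ 2"
      using contractible_imp_holomorphic_sqrt[of "\<lambda>z. 1 - F z / c" "ball 0 1"] by blast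
    have H0: "H 0 ^ 2 = 1" using H(2)[of 0] F by simp
    then have H0': "H 0 \<noteq> 0" by auto
    \<comment> \<open>Schottky's theorem asks for holomorphy on a closed disc; the scaling by 3/4
      provides it and takes |z| < 1/2 to radius 2/3, the value of t in \<open>B\<close>.\<close>
    define G where "G z = - (H ((3/4) * z) / H 0)" for z
    have in34: "(3/4) * z \<in> ball 0 1" if "norm z \<le> 1" for z :: complex
      using that by (simp add: norm_mult)
    have "norm (G ((4/3) * z)) \<le> B"
      unfolding B_def
    proof (rule Schottky[where f = G and r = 1 and t = "2/3"])
      have "(H \<circ> (\<lambda>z. (3/4) * z)) holomorphic_on cball 0 1"
        by (intro holomorphic_on_compose_gen[OF _ H(1)]) (auto intro!: holomorphic_intros simp: norm_mult)
      then show "G holomorphic_on cball 0 1"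
        unfolding G_def o_def using H0' by (intro holomorphic_intros) auto
      show "norm (G 0) \<le> 1" using H0' by (simp add: G_def)
      show "\<not> (G u = 0 \<or> G u = 1)" if u: "u \<in> cball 0 1" for u
      proof -
        have v: "(3/4) * u \<in> ball 0 1" using u in34 by simp
        have "H ((3/4) * u) \<noteq> 0"
        proof
          assume "H ((3/4) * u) = 0"
          then have "F ((3/4) * u) = c" using H(2)[OF v] c0 by (simp add: field_simps)
          then show False using c(2) v by blast
        qed
        \<comment> \<open>At such a point \<open>F\<close> would take the value F 0, so injectivity
          would put the point at 0, where \<open>H\<close> has the value H 0 and not its
          negative.\<close>
        moreover have "H ((3/4) * u) \<noteq> - H 0"
        proof
          assume eq: "H ((3/4) * u) = - H 0"
          then have "F ((3/4) * u) = F 0" using H(2)[OF v] H0 c0 F(1) by simp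
          then have "(3/4) * u = 0" using inj v by (metis centre_in_ball inj_onD zero_less_one)
          then show False using eq H0' by simp
        qed
        moreover have "H ((3/4) * u) = - (G u * H 0)" using H0' by (simp add: G_def)
        ultimately show ?thesis by auto
      qed
      show "norm ((4/3) * z) \<le> 2/3" using z by (simp add: norm_mult)
    qed auto
    then have "norm (H z) \<le> B * norm (H 0)"
      using H0' by (simp add: G_def norm_divide field_simps)
    moreover have "norm (H 0) = 1"
      using H0 by (auto simp: power2_eq_1_iff)
    ultimately have Hz: "norm (H z) \<le> B" by simp
    have zb: "z \<in> ball 0 1" using z by simp
    have "F z = c * (1 - (H z)\<^sup>2)" using H(2)[OF zb] c0 by (simp add: field_simps)
    then have "norm (F z) = norm c * norm (1 - (H z)\<^sup>2)" by (simp add: norm_mult)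
    also have "\<dots> \<le> 2 * (1 + B\<^sup>2)"
    proof (rule mult_mono)
      have "norm (1 - (H z)\<^sup>2) \<le> 1 + (norm (H z))\<^sup>2"
        using norm_triangle_ineq4[of 1 "(H z)\<^sup>2"] by (simp add: norm_power)
      also have "\<dots> \<le> 1 + B\<^sup>2" using Hz by (simp add: power_mono)
      finally show "norm (1 - (H z)\<^sup>2) \<le> 1 + B\<^sup>2" .
    qed (use c in auto)
    finally show "norm (F z) \<le> 2 * (1 + B\<^sup>2)" .
  qed
qed

text \<open>The common bound on the half disc gives normality by Montel's theorem. Derivatives pass
  to locally uniform limits, so the limit keeps derivative 1 at 0 and does not degenerate to a
  constant.\<close>

lemma injective_normalized_normal:
  assumes hol: "\<And>n. F n holomorphic_on ball 0 1" and inj: "\<And>n. inj_on (F n) (ball 0 1)"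
    and F: "\<And>n. F n 0 = 0" "\<And>n. deriv (F n) 0 = 1"
  obtains \<Phi> \<sigma> where "\<Phi> holomorphic_on ball 0 (1/2)" "strict_mono (\<sigma> :: nat \<Rightarrow> nat)"
    "\<And>z. norm z < 1/2 \<Longrightarrow> (\<lambda>n. F (\<sigma> n) z) \<longlonglongrightarrow> \<Phi> z" "deriv \<Phi> 0 = 1"
proof -
  obtain M where M: "\<And>F z. F holomorphic_on ball 0 1 \<Longrightarrow> inj_on F (ball 0 1) \<Longrightarrow> F 0 = 0 \<Longrightarrow>
     deriv F 0 = 1 \<Longrightarrow> norm z < 1 / 2 \<Longrightarrow> norm (F z) \<le> M"
    using injective_normalized_bounded by blast
  define \<H> where "\<H> = {h. h holomorphic_on ball 0 (1/2) \<and> (\<forall>z\<in>ball 0 (1/2). norm (h z) \<le> M)}"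
  have FH: "F n holomorphic_on ball 0 (1/2)" for n
    by (rule holomorphic_on_subset[OF hol]) auto
  have bdd: "\<exists>B. \<forall>h \<in> \<H>. \<forall>z \<in> K. norm (h z) \<le> B" if "K \<subseteq> ball 0 (1/2)" for K
    using that by (intro exI[of _ M]) (auto simp: \<H>_def)
  have rng: "range F \<subseteq> \<H>"
    using FH M[OF hol inj F] by (auto simp: \<H>_def)
  obtain \<Phi> \<sigma> where \<Phi>: "\<Phi> holomorphic_on ball 0 (1/2)" "strict_mono (\<sigma> :: nat \<Rightarrow> nat)"
    "\<And>x. x \<in> ball 0 (1/2) \<Longrightarrow> (\<lambda>n. F (\<sigma> n) x) \<longlonglongrightarrow> \<Phi> x"
    "\<And>K. \<lbrakk>compact K; K \<subseteq> ball 0 (1/2)\<rbrakk> \<Longrightarrow> uniform_limit K (F \<circ> \<sigma>) \<Phi> sequentially"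
    by (rule Montel[of "ball 0 (1/2)" \<H> F]) (use bdd rng in \<open>auto simp: \<H>_def\<close>)
  have "(\<lambda>n. deriv ((F \<circ> \<sigma>) n) 0) \<longlonglongrightarrow> deriv \<Phi> 0"
  proof (rule deriv_complex_uniform_limit)
    show "uniform_limit (ball 0 (1/4)) (F \<circ> \<sigma>) \<Phi> sequentially"
      by (rule uniform_limit_on_subset[OF \<Phi>(4)[of "cball 0 (1/4)"]]) auto
    show "\<forall>\<^sub>F n in sequentially. (F \<circ> \<sigma>) n holomorphic_on ball 0 (1/4)"
      by (auto intro!: always_eventually holomorphic_on_subset[OF hol])
  qed auto
  then have "deriv \<Phi> 0 = 1" by (simp add: F LIMSEQ_const_iff)
  with \<Phi> show ?thesis using that[of \<Phi> \<sigma>] by simp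
qed

section \<open>Curves contracted to the origin\<close>

text \<open>Only the coordinate \<open>K\<close> is recorded; injectivity and holomorphy already
  make its image open and its inverse holomorphic.\<close>

definition holomorphic_chart_at :: "complex set \<Rightarrow> complex \<Rightarrow> bool" where
  "holomorphic_chart_at \<gamma> q \<longleftrightarrow> (\<exists>K U. open U \<and> q \<in> U \<and> K holomorphic_on U \<and> inj_on K U \<and>
     (\<forall>z\<in>U. z \<in> \<gamma> \<longleftrightarrow> Im (K z) = 0))"

text \<open>The affine change z -> q + r z reduces to the unit disc. Univalence makes every
  \<open>deriv (F n) q\<close> nonzero, so dividing by it is legitimate.\<close>

lemma injective_holomorphic_normal:
  assumes hol: "\<And>n. F n holomorphic_on ball q r" and inj: "\<And>n. inj_on (F n) (ball q r)" and r: "r > 0"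
  obtains \<Phi> \<sigma> where "\<Phi> holomorphic_on ball q (r / 2)" "strict_mono (\<sigma> :: nat \<Rightarrow> nat)"
    "\<And>z. z \<in> ball q (r / 2) \<Longrightarrow>
       (\<lambda>n. (F (\<sigma> n) z - F (\<sigma> n) q) / deriv (F (\<sigma> n)) q) \<longlonglongrightarrow> \<Phi> z"
    "deriv \<Phi> q = 1"
proof -
  define a where "a n = of_real r * deriv (F n) q" for n
  define G where "G n z = (F n (q + of_real r * z) - F n q) / a n" for n z
  have dF: "deriv (F n) q \<noteq> 0" for n
    by (rule holomorphic_injective_imp_regular[OF hol open_ball inj]) (use r in auto)
  then have a0: "a n \<noteq> 0" for n using r by (simp add: a_def)
  have inb: "q + of_real r * z \<in> ball q r \<longleftrightarrow> norm z < 1" for z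
    using r by (simp add: dist_norm norm_mult)
  have derG: "(G n has_field_derivative deriv (F n) (q + of_real r * z) * of_real r / a n) (at z)" if "norm z < 1" for n z
  proof -
    have "F n field_differentiable at (q + of_real r * z)"
      using hol inb[of z] that holomorphic_on_imp_differentiable_at open_ball by blast
    then have "((\<lambda>z. F n (q + of_real r * z)) has_field_derivative deriv (F n) (q + of_real r * z) * of_real r) (at z)"
      by (intro DERIV_chain2) (auto intro!: derivative_eq_intros simp: DERIV_deriv_iff_field_differentiable)
    then show ?thesis
      unfolding G_def[abs_def] using a0 by (auto intro!: derivative_eq_intros)
  qed
  have holG: "G n holomorphic_on ball 0 1" for n
    using derG by (intro holomorphic_onI) (auto simp: field_differentiable_def intro: DERIV_subset)
  have injG: "inj_on (G n) (ball 0 1)" for n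
  proof (rule inj_onI)
    fix x y :: complex assume xy: "x \<in> ball 0 1" "y \<in> ball 0 1" "G n x = G n y"
    then have "F n (q + of_real r * x) = F n (q + of_real r * y)" using a0[of n] by (simp add: G_def)
    then have "q + of_real r * x = q + of_real r * y"
      using inj[of n] inb[of x] inb[of y] xy by (metis inj_onD mem_ball_0)
    then show "x = y" using r by simp
  qed
  have G0: "G n 0 = 0" for n by (simp add: G_def)
  have dG0: "deriv (G n) 0 = 1" for n
    using DERIV_imp_deriv[OF derG[of 0 n]] r dF by (simp add: a_def)
  obtain \<Psi> \<sigma> where \<Psi>: "\<Psi> holomorphic_on ball 0 (1/2)" "strict_mono (\<sigma> :: nat \<Rightarrow> nat)"
    "\<And>z. norm z < 1/2 \<Longrightarrow> (\<lambda>n. G (\<sigma> n) z) \<longlonglongrightarrow> \<Psi> z" "deriv \<Psi> 0 = 1"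
    using injective_normalized_normal[of G, OF holG injG G0 dG0] by blast
  define \<Phi> where "\<Phi> z = of_real r * \<Psi> ((z - q) / of_real r)" for z
  have inb2: "norm ((z - q) / of_real r) < 1/2 \<longleftrightarrow> z \<in> ball q (r / 2)" for z
    using r by (simp add: dist_norm norm_divide field_simps norm_minus_commute)
  have der\<Phi>: "(\<Phi> has_field_derivative deriv \<Psi> ((z - q) / of_real r)) (at z)" if "z \<in> ball q (r / 2)" for z
  proof -
    have "\<Psi> field_differentiable at ((z - q) / of_real r)"
      using \<Psi>(1) inb2[of z] that holomorphic_on_imp_differentiable_at[of \<Psi> "ball 0 (1/2)"] by simp
    then have "((\<lambda>z. \<Psi> ((z - q) / of_real r)) has_field_derivative deriv \<Psi> ((z - q) / of_real r) * (1 / of_real r)) (at z)"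
      by (intro DERIV_chain2) (use r in \<open>auto intro!: derivative_eq_intros simp: DERIV_deriv_iff_field_differentiable\<close>)
    from DERIV_cmult[OF this, of "of_real r"] show ?thesis
      unfolding \<Phi>_def[abs_def] using r by simp
  qed
  show ?thesis
  proof (rule that[of \<Phi> \<sigma>])
    show "\<Phi> holomorphic_on ball q (r / 2)"
      using der\<Phi> by (intro holomorphic_onI) (auto simp: field_differentiable_def intro: DERIV_subset)
    show "strict_mono \<sigma>" by (rule \<Psi>)
    show "deriv \<Phi> q = 1" using DERIV_imp_deriv[OF der\<Phi>[of q]] r \<Psi>(4) by simp
    fix z assume z: "z \<in> ball q (r / 2)"
    have "(\<lambda>n. of_real r * G (\<sigma> n) ((z - q) / of_real r)) \<longlonglongrightarrow> \<Phi> z"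
      unfolding \<Phi>_def using z inb2 by (intro tendsto_mult_left \<Psi>(3)) blast
    then show "(\<lambda>n. (F (\<sigma> n) z - F (\<sigma> n) q) / deriv (F (\<sigma> n)) q) \<longlonglongrightarrow> \<Phi> z"
      using r by (simp add: G_def a_def)
  qed
qed

lemma funpow_invariant_holomorphic:
  assumes "open P" and hol: "g holomorphic_on P" and inj: "inj_on g P" and inv: "g ` P \<subseteq> P"
  shows "(g ^^ n) holomorphic_on P \<and> inj_on (g ^^ n) P \<and> (g ^^ n) ` P \<subseteq> P"
proof (induction n)
  case (Suc n)
  have "(g \<circ> (g ^^ n)) holomorphic_on P"
    using Suc hol by (intro holomorphic_on_compose_gen[of _ _ g P]) auto
  moreover have "inj_on (g \<circ> (g ^^ n)) P"
    using Suc inj by (intro comp_inj_on) (auto intro: inj_on_subset)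
  moreover have "(g \<circ> (g ^^ n)) ` P \<subseteq> P"
    using Suc inv by auto
  ultimately show ?case by (simp add: o_def)
qed (auto simp: holomorphic_on_id)

text \<open>The chart is \<open>\<Phi>(z) / \<Phi>(q\<^sub>1)\<close> with \<open>q\<^sub>1\<close> on the curve and \<open>\<Phi>\<close> a limit of affinely normalised
  iterates of \<open>g\<close>. On the curve it is a limit of quotients of two chords of the curve whose
  endpoints tend to \<open>0\<close>; both chords tend to the direction of the tangent at \<open>0\<close>, so it is real.\<close>

lemma contracted_curve_holomorphic_chart:
  assumes P: "open P" and hol: "g holomorphic_on P" and inj: "inj_on g P" and inv: "g ` P \<subseteq> P"
    and lim: "\<And>z. z \<in> P \<Longrightarrow> (\<lambda>n. (g ^^ n) z) \<longlonglongrightarrow> 0"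
    and \<gamma>: "\<And>z. z \<in> \<gamma> \<inter> P \<Longrightarrow> g z \<in> \<gamma>"
    and chord: "\<And>\<epsilon>. \<epsilon> > 0 \<Longrightarrow> \<exists>\<delta>>0. \<forall>a\<in>\<gamma> \<inter> ball 0 \<delta>. \<forall>b\<in>\<gamma> \<inter> ball 0 \<delta>.
       \<bar>Im (w * (a - b))\<bar> \<le> \<epsilon> * norm (w * (a - b))" and w: "w \<noteq> 0"
    and st: "straightens \<phi> \<psi> U V \<gamma>" and q: "q \<in> U" "q \<in> \<gamma>" "q \<in> P"
  shows "holomorphic_chart_at \<gamma> q"
proof -
  note it = funpow_invariant_holomorphic[OF P hol inj inv]
  obtain r where r: "r > 0" "ball q r \<subseteq> P" using P q open_contains_ball by blast
  have "(g ^^ n) holomorphic_on ball q r" "inj_on (g ^^ n) (ball q r)" for n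
    using it r(2) holomorphic_on_subset inj_on_subset by blast+
  from injective_holomorphic_normal[of "\<lambda>n. g ^^ n", OF this r(1)]
  obtain \<Phi> \<sigma> where \<Phi>: "\<Phi> holomorphic_on ball q (r / 2)" "strict_mono (\<sigma> :: nat \<Rightarrow> nat)"
    "\<And>z. z \<in> ball q (r / 2) \<Longrightarrow>
       (\<lambda>n. ((g ^^ \<sigma> n) z - (g ^^ \<sigma> n) q) / deriv (g ^^ \<sigma> n) q) \<longlonglongrightarrow> \<Phi> z"
    "deriv \<Phi> q = 1"
    by blast
  have qb: "q \<in> ball q (r / 2)" using r by simp
  have "deriv \<Phi> q \<noteq> 0" using \<Phi>(4) by simp
  from has_complex_derivative_locally_invertible[OF \<Phi>(1) qb open_ball this]
  obtain s where s: "s > 0" "ball q s \<subseteq> ball q (r / 2)" "inj_on \<Phi> (ball q s)" by metis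
  have \<Phi>q: "\<Phi> q = 0" using LIMSEQ_unique[OF \<Phi>(3)[OF qb]] by simp
  have "ball q (r / 2) \<subseteq> ball q r" using r(1) by (intro subset_ball) simp
  then have sP: "ball q s \<subseteq> P" using s(2) r(2) by blast
  \<comment> \<open>Dividing by the image of a second point of the curve turns the line that
    contains the image of the curve into the real axis.\<close>
  obtain q1 where q1: "q1 \<in> \<gamma>" "q1 \<in> ball q s" "q1 \<noteq> q"
    using straightens_islimpt[OF st q(1,2)] s(1) unfolding islimpt_def
    by (metis centre_in_ball open_ball)
  have \<Phi>q1: "\<Phi> q1 \<noteq> 0" using s(1,3) q1 \<Phi>q by (metis centre_in_ball inj_onD)
  define K where "K z = \<Phi> z / \<Phi> q1" for z
  have holK: "K holomorphic_on ball q s"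
    unfolding K_def using \<Phi>(1) s(2) \<Phi>q1 by (intro holomorphic_intros) (auto intro: holomorphic_on_subset)
  have injK: "inj_on K (ball q s)"
    using s(3) \<Phi>q1 by (auto simp: K_def inj_on_def)
  have Kq: "K q = 0" by (simp add: K_def \<Phi>q)
  have orbit: "(g ^^ n) z \<in> \<gamma>" if "z \<in> \<gamma> \<inter> P" for n z
  proof (induction n)
    case (Suc n)
    then show ?case using \<gamma>[of "(g ^^ n) z"] it[of n] that by auto
  qed (use that in simp)
  have real: "Im (K z) = 0" if z: "z \<in> \<gamma> \<inter> ball q s" for z
  proof -
    have zP: "z \<in> \<gamma> \<inter> P" "q1 \<in> \<gamma> \<inter> P" using z q1 sP by auto
    define c d where "c n = (g ^^ \<sigma> n) z - (g ^^ \<sigma> n) q" and "d n = (g ^^ \<sigma> n) q1 - (g ^^ \<sigma> n) q" for n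
    have dq: "deriv (g ^^ n) q \<noteq> 0" for n
      using holomorphic_injective_imp_regular[OF _ P _ q(3)] it by blast
    have "(\<lambda>n. (c n / deriv (g ^^ \<sigma> n) q) / (d n / deriv (g ^^ \<sigma> n) q)) \<longlonglongrightarrow> K z"
      unfolding K_def c_def d_def using z q1 s(2) \<Phi>q1 by (intro tendsto_divide \<Phi>(3)) auto
    \<comment> \<open>The normalising derivatives cancel and only quotients of chords of the curve
      remain.\<close>
    then have cd: "(\<lambda>n. c n / d n) \<longlonglongrightarrow> K z"
      using dq by simp
    have small: "\<forall>\<^sub>F n in sequentially. (g ^^ \<sigma> n) y \<in> ball 0 \<delta>" if "y \<in> P" "\<delta> > 0" for y \<delta>
    proof -
      have "(\<lambda>n. (g ^^ \<sigma> n) y) \<longlonglongrightarrow> 0"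
        using LIMSEQ_subseq_LIMSEQ[OF lim[OF that(1)] \<Phi>(2)] by (simp add: o_def)
      then show ?thesis using that(2) by (intro topological_tendstoD) auto
    qed
    have *: "\<bar>Im (K z)\<bar> \<le> 2 * \<epsilon> * norm (K z)" if \<epsilon>: "\<epsilon> > 0" for \<epsilon>
    proof (rule tendsto_le)
      show "(\<lambda>n. 2 * \<epsilon> * norm (c n / d n)) \<longlonglongrightarrow> 2 * \<epsilon> * norm (K z)"
        by (intro tendsto_intros cd)
      show "(\<lambda>n. \<bar>Im (c n / d n)\<bar>) \<longlonglongrightarrow> \<bar>Im (K z)\<bar>"
        by (intro tendsto_intros cd)
      obtain \<delta> where \<delta>: "\<delta> > 0" "\<forall>a\<in>\<gamma> \<inter> ball 0 \<delta>. \<forall>b\<in>\<gamma> \<inter> ball 0 \<delta>.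
         \<bar>Im (w * (a - b))\<bar> \<le> \<epsilon> * norm (w * (a - b))" using chord[OF \<epsilon>] by blast
      have "\<forall>\<^sub>F n in sequentially. (g ^^ \<sigma> n) z \<in> ball 0 \<delta> \<and> (g ^^ \<sigma> n) q1 \<in> ball 0 \<delta> \<and> (g ^^ \<sigma> n) q \<in> ball 0 \<delta>"
        using small[OF _ \<delta>(1)] zP q by (intro eventually_conj) auto
      then show "\<forall>\<^sub>F n in sequentially. \<bar>Im (c n / d n)\<bar> \<le> 2 * \<epsilon> * norm (c n / d n)"
      proof eventually_elim
        case (elim n)
        then have "\<bar>Im (w * c n)\<bar> \<le> \<epsilon> * norm (w * c n)" "\<bar>Im (w * d n)\<bar> \<le> \<epsilon> * norm (w * d n)"
          using \<delta>(2) orbit[OF zP(1)] orbit[OF zP(2)] orbit[of q] q unfolding c_def d_def by blast+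
        from Im_divide_le[OF this] show ?case using w by simp
      qed
    qed simp

    show ?thesis
    proof (rule ccontr)
      assume "Im (K z) \<noteq> 0"
      then have "norm (K z) > 0" "\<bar>Im (K z)\<bar> > 0" by auto
      \<comment> \<open>This \<open>\<epsilon>\<close> would bound |Im (K z)| by half of
        itself.\<close>
      then show False using *[of "\<bar>Im (K z)\<bar> / (4 * norm (K z))"] by simp
    qed
  qed
  obtain \<delta> where \<delta>: "\<delta> > 0" "\<And>t. Im t = 0 \<Longrightarrow> norm (t - K q) < \<delta> \<Longrightarrow> t \<in> K ` (\<gamma> \<inter> ball q s)"
  proof (rule straightens_real_nbhd[OF st q(1,2), of "ball q s" K])
    show "continuous_on (\<gamma> \<inter> ball q s) K"
      using holK by (meson continuous_on_subset holomorphic_on_imp_continuous_on inf_le2)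
    show "inj_on K (\<gamma> \<inter> ball q s)" using injK by (rule inj_on_subset) auto
  qed (use s(1) real in auto)
  \<comment> \<open>For the converse, a real value \<open>K z\<close> must force \<open>z\<close>
    onto the curve. On \<open>U'\<close> such a value lies within \<open>\<delta>\<close> of 0 = K
    q, hence is attained on the curve, and injectivity of \<open>K\<close> identifies the two
    points.\<close>
  define U' where "U' = ball q s \<inter> K -` ball 0 \<delta>"
  have "open U'"
    unfolding U'_def
    using continuous_open_preimage[OF holomorphic_on_imp_continuous_on[OF holK] open_ball open_ball] .
  moreover have "q \<in> U'" using s(1) \<delta>(1) by (simp add: U'_def Kq)
  moreover have "K holomorphic_on U'" "inj_on K U'"
    using holK injK by (auto simp: U'_def intro: holomorphic_on_subset inj_on_subset)
  moreover have "z \<in> \<gamma> \<longleftrightarrow> Im (K z) = 0" if z: "z \<in> U'" for z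
  proof
    assume "Im (K z) = 0"
    then have "K z \<in> K ` (\<gamma> \<inter> ball q s)" using \<delta>(2)[of "K z"] z by (simp add: U'_def Kq)
    then show "z \<in> \<gamma>" using injK z by (auto simp: U'_def dest: inj_onD)
  qed (use real z in \<open>auto simp: U'_def\<close>)
  ultimately show ?thesis unfolding holomorphic_chart_at_def by blast
qed

section \<open>Attracting petals\<close>

text \<open>Used contrapositively: a large real part of -1 / (a z^k) forces z close to 0.\<close>

lemma reciprocal_power_large_imp_small:
  fixes a :: complex
  assumes "a \<noteq> 0" "e > 0" "norm z \<ge> e"
  shows "Re (- 1 / (a * z ^ k)) \<le> 1 / (norm a * e ^ k)"
proof -
  have "Re (- 1 / (a * z ^ k)) \<le> norm (- 1 / (a * z ^ k))"
    by (rule complex_Re_le_cmod)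
  also have "\<dots> = 1 / (norm a * norm z ^ k)"
    by (simp add: norm_divide norm_mult norm_power)
  also have "\<dots> \<le> 1 / (norm a * e ^ k)"
    using assms by (intro divide_left_mono mult_left_mono power_mono mult_pos_pos zero_less_power) auto
  finally show ?thesis .
qed

text \<open>\<open>-1 / (a z\<^sup>k)\<close> is, up to the factor \<open>1/k\<close>, the approximate Fatou coordinate of
  \<open>g(z) = z + a z\<^sup>k\<^sup>+\<^sup>1 + \<dots>\<close>.\<close>

lemma fatou_coordinate_increment:
  fixes a :: complex
  assumes a: "a \<noteq> 0" and k: "k \<ge> 1" and g: "((\<lambda>z. (g z - z) / z ^ Suc k) \<longlongrightarrow> a) (at 0)"
  shows "((\<lambda>z. - 1 / (a * g z ^ k) - (- 1 / (a * z ^ k))) \<longlongrightarrow> of_nat k) (at 0)"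
    and "\<forall>\<^sub>F z in at 0. g z \<noteq> 0"
proof -
  define s where "s z = (g z - z) / z" for z
  have "((\<lambda>z. z ^ k * ((g z - z) / z ^ Suc k)) \<longlongrightarrow> 0 ^ k * a) (at 0)"
    by (intro tendsto_intros g)
  moreover have "\<forall>\<^sub>F z in at 0. z ^ k * ((g z - z) / z ^ Suc k) = s z"
    unfolding eventually_at_filter by (rule always_eventually) (simp add: s_def)
  \<comment> \<open>Here k >= 1 matters: the factor z^k turns a finite limit into 0, so g z = z (1 +
    s z) with a small relative error.\<close>
  ultimately have s: "(s \<longlongrightarrow> 0) (at 0)"
    using k by (simp add: power_0_left cong: filterlim_cong)
  have "((\<lambda>z. 1 + s z) \<longlongrightarrow> 1 + 0) (at 0)"
    by (intro tendsto_intros s)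
  then have nz: "\<forall>\<^sub>F z in at 0. 1 + s z \<noteq> 0"
    by (rule tendsto_imp_eventually_ne) simp
  have gz: "g z = z * (1 + s z)" if "z \<noteq> 0" for z
    using that by (simp add: s_def field_simps)
  show "\<forall>\<^sub>F z in at 0. g z \<noteq> 0"
    using nz eventually_neq_at_within[of 0 0] by eventually_elim (simp add: gz)
  \<comment> \<open>Writing (1 + s)^k - 1 as s times a geometric sum cancels the factor z^k. The
    first factor tends to 1, the geometric sum to k.\<close>
  have "((\<lambda>z. ((g z - z) / z ^ Suc k / a) * ((\<Sum>i<k. (1 + s z) ^ i) / (1 + s z) ^ k))
      \<longlongrightarrow> (a / a) * ((\<Sum>i<k. (1 + 0) ^ i) / (1 + 0) ^ k)) (at 0)"
    by (intro tendsto_intros g s) (use a in auto)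
  moreover have "\<forall>\<^sub>F z in at 0. ((g z - z) / z ^ Suc k / a) * ((\<Sum>i<k. (1 + s z) ^ i) / (1 + s z) ^ k) =
      - 1 / (a * g z ^ k) - (- 1 / (a * z ^ k))"
    using nz eventually_neq_at_within[of 0 0]
  proof eventually_elim
    case (elim z)
    have "(1 + s z) ^ k - 1 = s z * (\<Sum>i<k. (1 + s z) ^ i)"
      using power_diff_1_eq[of "1 + s z" k] by simp
    moreover have "(g z - z) / z ^ Suc k = s z / z ^ k" by (simp add: s_def)
    ultimately have "((g z - z) / z ^ Suc k / a) * ((\<Sum>i<k. (1 + s z) ^ i) / (1 + s z) ^ k) =
        ((1 + s z) ^ k - 1) / (a * z ^ k * (1 + s z) ^ k)"
      by simp
    also have "\<dots> = - 1 / (a * g z ^ k) - (- 1 / (a * z ^ k))"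
    proof -
      have "(w - 1) / (a * u * w) = - 1 / (a * (u * w)) - (- 1 / (a * u))" if "u \<noteq> 0" "w \<noteq> 0" for u w
        using that a by (simp add: field_simps)
      from this[of "z ^ k" "(1 + s z) ^ k"] show ?thesis
        using elim by (simp add: gz power_mult_distrib)
    qed
    finally show ?case .
  qed
  ultimately have "((\<lambda>z. - 1 / (a * g z ^ k) - (- 1 / (a * z ^ k)))
      \<longlongrightarrow> (a / a) * ((\<Sum>i<k. (1 + 0) ^ i) / (1 + 0) ^ k)) (at 0)"
    by (rule Lim_transform_eventually)
  then show "((\<lambda>z. - 1 / (a * g z ^ k) - (- 1 / (a * z ^ k))) \<longlongrightarrow> of_nat k) (at 0)"
    using a by simp
qed

text \<open>In the coordinate v = -1 / (a z^k) the map moves points to the right by more than 1/2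
  per step near 0. A half plane Re v > R therefore pulls back to an invariant open set, all
  attracting petals at once, and the growth of Re v along orbits forces convergence to 0.\<close>

lemma attracting_petals:
  fixes a :: complex
  assumes a: "a \<noteq> 0" and k: "k \<ge> 1" and g: "((\<lambda>z. (g z - z) / z ^ Suc k) \<longlongrightarrow> a) (at 0)"
    and \<rho>: "\<rho> > 0"
  obtains R P where "open P" "P \<subseteq> ball 0 \<rho>" "g ` P \<subseteq> P" "\<And>z. z \<in> P \<Longrightarrow> (\<lambda>n. (g ^^ n) z) \<longlonglongrightarrow> 0"
    "\<And>z. z \<noteq> 0 \<Longrightarrow> Re (- 1 / (a * z ^ k)) > R \<Longrightarrow> z \<in> P"
proof -
  define v where "v z = - 1 / (a * z ^ k)" for z
  have "((\<lambda>z. Re (v (g z) - v z)) \<longlongrightarrow> real k) (at 0)"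
    using tendsto_Re[OF fatou_coordinate_increment(1)[OF a k g]] by (simp add: v_def)
  then have "\<forall>\<^sub>F z in at 0. Re (v (g z) - v z) > 1 / 2"
    using k by (intro order_tendstoD(1)) auto
  then have "\<forall>\<^sub>F z in at 0. Re (v (g z) - v z) > 1 / 2 \<and> g z \<noteq> 0"
    using fatou_coordinate_increment(2)[OF a k g] by eventually_elim simp
  then obtain d where d: "d > 0" "\<And>z. z \<noteq> 0 \<Longrightarrow> norm z < d \<Longrightarrow> Re (v (g z)) > Re (v z) + 1 / 2 \<and> g z \<noteq> 0"
    unfolding eventually_at by (auto simp: dist_norm algebra_simps)
  define r where "r = min d \<rho>"
  have r: "r > 0" using d \<rho> by (simp add: r_def)
  have vR: "norm z < e" if "e > 0" "Re (v z) > 1 / (norm a * e ^ k)" for z e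
    using reciprocal_power_large_imp_small[OF a that(1), of z k] that(2) unfolding v_def by linarith
  \<comment> \<open>Beyond this threshold |z| < r, which gives both the increment estimate and
    containment in the ball of radius \<open>\<rho>\<close>.\<close>
  define R where "R = 1 / (norm a * r ^ k)"
  define P where "P = {z \<in> - {0}. Re (v z) > R}"
  have Pr: "norm z < r" if "z \<in> P" for z
    using vR[OF r, of z] that by (simp add: P_def R_def)
  have step: "Re (v (g z)) > Re (v z) + 1 / 2 \<and> g z \<in> P" if "z \<in> P" for z
    using d(2)[of z] Pr[OF that] that by (auto simp: P_def r_def)
  show ?thesis
  proof (rule that[of P R])
    have "continuous_on (- {0}) (\<lambda>z. Re (v z))"
      unfolding v_def using a by (intro continuous_intros) auto
    from continuous_open_preimage[OF this _ open_greaterThan[of R]]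
    have "open (- {0} \<inter> (\<lambda>z. Re (v z)) -` {R<..})" by auto
    moreover have "- {0} \<inter> (\<lambda>z. Re (v z)) -` {R<..} = P" by (auto simp: P_def)
    ultimately show "open P" by simp
    show "P \<subseteq> ball 0 \<rho>" using Pr by (force simp: r_def)
    show "g ` P \<subseteq> P" using step by blast
    show "z \<in> P" if "z \<noteq> 0" "Re (- 1 / (a * z ^ k)) > R" for z
      using that by (simp add: P_def v_def)
    fix z assume z: "z \<in> P"
    have grow: "(g ^^ n) z \<in> P \<and> Re (v ((g ^^ n) z)) \<ge> R + real n / 2" for n
    proof (induction n)
      case (Suc n)
      then show ?case using step[of "(g ^^ n) z"] by (auto simp: field_simps)
    qed (use z in \<open>auto simp: P_def\<close>)
    show "(\<lambda>n. (g ^^ n) z) \<longlonglongrightarrow> 0"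
    proof (rule tendstoI)
      fix e :: real assume e: "e > 0"
      define T where "T = 1 / (norm a * e ^ k)"
      obtain N :: nat where N: "2 * (T - R) < real N"
        using reals_Archimedean2 by blast
      show "\<forall>\<^sub>F n in sequentially. dist ((g ^^ n) z) 0 < e"
        using eventually_ge_at_top[of N]
      proof eventually_elim
        case (elim n)
        then have "real N \<le> real n" by simp
        then have "Re (v ((g ^^ n) z)) > T" using grow[of n, THEN conjunct2] N by argo
        then show ?case using vR[OF e] by (simp add: T_def)
      qed
    qed
  qed
qed

section \<open>Germs tangent to the identity and their inverses\<close>

text \<open>With u = h z, the difference h z - z is -(g u - u), and u / z tends to 1, so powers of u
  may be replaced by powers of z. The change of sign exchanges attracting and repelling
  directions.\<close>

lemma tangency_coefficient_inverse:
  fixes a :: complex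
  assumes g: "((\<lambda>z. (g z - z) / z ^ Suc k) \<longlongrightarrow> a) (at 0)" and "g 0 = 0"
    and h: "(h has_field_derivative 1) (at 0)" "h 0 = 0" and gh: "\<forall>\<^sub>F z in nhds 0. g (h z) = z"
  shows "((\<lambda>z. (h z - z) / z ^ Suc k) \<longlongrightarrow> - a) (at 0)"
proof -
  have gh': "\<forall>\<^sub>F z in at 0. g (h z) = z"
    using gh unfolding eventually_at_filter by eventually_elim simp
  have ne: "\<forall>\<^sub>F z in at 0. h z \<noteq> 0"
    using gh' eventually_neq_at_within[of 0 0] by eventually_elim (use assms(2) in auto)
  have "(h \<longlongrightarrow> 0) (at 0)"
    using DERIV_isCont[OF h(1)] h(2) by (simp add: isCont_def)
  then have "filterlim h (at 0) (at 0)"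
    using ne by (intro filterlim_atI)
  from filterlim_compose[OF g this]
  have 1: "((\<lambda>z. (g (h z) - h z) / h z ^ Suc k) \<longlongrightarrow> a) (at 0)" .
  have 2: "((\<lambda>z. h z / z) \<longlongrightarrow> 1) (at 0)"
    using h by (simp add: DERIV_def)
  have "((\<lambda>z. - ((g (h z) - h z) / h z ^ Suc k) * (h z / z) ^ Suc k) \<longlongrightarrow> - a * 1 ^ Suc k) (at 0)"
    by (intro tendsto_intros 1 2)
  moreover have "\<forall>\<^sub>F z in at 0. - ((g (h z) - h z) / h z ^ Suc k) * (h z / z) ^ Suc k = (h z - z) / z ^ Suc k"
    using gh' ne eventually_neq_at_within[of 0 0]
    by eventually_elim (simp add: power_divide minus_divide_left del: power_Suc)
  ultimately show ?thesis
    by (simp cong: filterlim_cong del: power_Suc)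
qed

text \<open>\<open>Suc k\<close> is the order of the zero of g - id at 0 and \<open>a\<close> the
  value of the cofactor there. Derivative 1 excludes order 1.\<close>

lemma parabolic_tangency_coefficient:
  assumes g: "g analytic_on {0}" "g 0 = 0" "deriv g 0 = 1" and ne: "\<not> (\<forall>\<^sub>F z in nhds 0. g z = z)"
  obtains a k where "a \<noteq> 0" "k \<ge> 1" "((\<lambda>z. (g z - z) / z ^ Suc k) \<longlongrightarrow> a) (at 0)"
proof -
  obtain e where e: "e > 0" "g holomorphic_on ball 0 e"
    using g(1) by (auto simp: analytic_at_ball)
  have zero: "0 \<in> ball (0::complex) e" using e by simp
  have hol: "(\<lambda>z. g z - z) holomorphic_on ball 0 e"
    by (intro holomorphic_intros e(2))
  have nc: "\<not> (\<lambda>z. g z - z) constant_on ball 0 e"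
  proof
    assume "(\<lambda>z. g z - z) constant_on ball 0 e"
    then obtain c where c: "\<And>z. z \<in> ball 0 e \<Longrightarrow> g z - z = c" unfolding constant_on_def by blast
    have "c = 0" using c[OF zero] g(2) by simp
    then have "\<forall>\<^sub>F z in nhds 0. g z = z"
      using c zero by (intro eventually_mono[OF eventually_nhds_in_open[OF open_ball zero]]) auto
    with ne show False by simp
  qed
  have "g 0 - 0 = 0" using g(2) by simp
  from holomorphic_factor_zero_nonconstant[OF hol open_ball connected_ball zero this nc]
  obtain h r n where n: "0 < n" and r: "0 < r" "h holomorphic_on ball 0 r"
    "\<And>z. z \<in> ball 0 r \<Longrightarrow> g z - z = (z - 0) ^ n * h z" "\<And>z. z \<in> ball 0 r \<Longrightarrow> h z \<noteq> 0"
    by metis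
  have h0: "h 0 \<noteq> 0" using r by simp
  have "isCont h 0"
    using holomorphic_on_imp_continuous_on[OF r(2)] r(1) by (simp add: continuous_on_eq_continuous_at)
  then have h: "(h \<longlongrightarrow> h 0) (at 0)" by (simp add: isCont_def)
  have near: "\<forall>\<^sub>F z in at 0. z \<in> ball (0::complex) r"
    using r(1) by (intro eventually_at_in_open') auto
  have ev: "\<forall>\<^sub>F z in at 0. h z = (g z - z) / z ^ n"
    using near eventually_neq_at_within[of 0 0] by eventually_elim (simp add: r(3))
  have lim: "((\<lambda>z. (g z - z) / z ^ n) \<longlongrightarrow> h 0) (at 0)"
    using h ev by (simp cong: filterlim_cong)
  have "n \<noteq> 1"
  proof
    assume "n = 1"
    have "(g has_field_derivative 1) (at 0)"
      using g by (metis DERIV_deriv_iff_field_differentiable analytic_on_imp_differentiable_at singletonI)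
    then have "((\<lambda>z. g z / z - 1) \<longlongrightarrow> 1 - 1) (at 0)"
      using g(2) by (intro tendsto_intros) (simp add: DERIV_def)
    moreover have "\<forall>\<^sub>F z in at 0. g z / z - 1 = (g z - z) / z ^ n"
      using eventually_neq_at_within[of 0 0] by eventually_elim (simp add: \<open>n = 1\<close> diff_divide_distrib)
    ultimately have "((\<lambda>z. (g z - z) / z ^ n) \<longlongrightarrow> 0) (at 0)"
      by (simp cong: filterlim_cong)
    then show False using lim h0 LIM_unique by blast
  qed
  then obtain k where "n = Suc k" "k \<ge> 1" using n by (cases n) auto
  then show ?thesis using that[of "h 0" k] lim h0 by simp
qed

section \<open>Invariant curves\<close>

text \<open>Univalent maps are open with holomorphic inverse, and holomorphic maps are
  real-analytic. Intersecting with \<open>N\<close> keeps the chart in a neighbourhood fixed in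
  advance.\<close>

lemma holomorphic_chart_at_real_analytic:
  assumes "holomorphic_chart_at \<gamma> q" "open N" "q \<in> N"
  obtains U V \<phi> \<psi> where "open U" "q \<in> U" "U \<subseteq> N" "open V" "homeomorphism U V \<phi> \<psi>"
    "real_analytic_on \<phi> U" "real_analytic_on \<psi> V" "\<phi> ` (\<gamma> \<inter> U) = {w \<in> V. Im w = 0}"
proof -
  obtain K U0 where K0: "open U0" "q \<in> U0" "K holomorphic_on U0" "inj_on K U0"
    "\<And>z. z \<in> U0 \<Longrightarrow> z \<in> \<gamma> \<longleftrightarrow> Im (K z) = 0"
    using assms(1) unfolding holomorphic_chart_at_def by blast
  define U where "U = U0 \<inter> N"
  have U: "open U" "q \<in> U" "U \<subseteq> N" "K holomorphic_on U" "inj_on K U"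
    using K0 assms(2,3) by (auto simp: U_def intro: holomorphic_on_subset inj_on_subset)
  have V: "open (K ` U)" by (rule open_mapping_thm3[OF U(4,1,5)])
  obtain G where G: "G holomorphic_on K ` U" "\<And>z. z \<in> U \<Longrightarrow> G (K z) = z"
    using holomorphic_has_inverse[OF U(4,1,5)] by metis
  show ?thesis
  proof (rule that[OF U(1-3) V])
    show "homeomorphism U (K ` U) K G"
      using U(4) G by (auto simp: homeomorphism_def holomorphic_on_imp_continuous_on image_iff)
    show "real_analytic_on K U" "real_analytic_on G (K ` U)"
      using U V G(1) unfolding real_analytic_on_def
      by (auto intro!: analytic_imp_real_analytic_at intro: holomorphic_on_imp_analytic_at)
    show "K ` (\<gamma> \<inter> U) = {w \<in> K ` U. Im w = 0}"
      using K0(5) by (auto simp: U_def)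
  qed
qed

lemma germ_real_analytic_off_0_if_charts:
  assumes "\<forall>\<^sub>F q in at 0. q \<in> \<gamma> \<longrightarrow> holomorphic_chart_at \<gamma> q"
  shows "germ_real_analytic_off_0 \<gamma>"
proof -
  obtain N where N: "open N" "0 \<in> N" "\<And>q. q \<in> N \<Longrightarrow> q \<noteq> 0 \<Longrightarrow> q \<in> \<gamma> \<Longrightarrow> holomorphic_chart_at \<gamma> q"
    using assms unfolding eventually_at_topological by auto
  have "real_analytic_off_0 (\<gamma> \<inter> N)"
    unfolding real_analytic_off_0_def
  proof (intro ballI impI)
    fix p assume p: "p \<in> \<gamma> \<inter> N" "p \<noteq> 0"
    then have "holomorphic_chart_at \<gamma> p" "p \<in> N" using N(3) by auto
    from holomorphic_chart_at_real_analytic[OF this(1) N(1) this(2)]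
    obtain U V \<phi> \<psi> where c: "open U" "p \<in> U" "U \<subseteq> N" "open V" "homeomorphism U V \<phi> \<psi>"
      "real_analytic_on \<phi> U" "real_analytic_on \<psi> V" "\<phi> ` (\<gamma> \<inter> U) = {w \<in> V. Im w = 0}"
      by blast
    \<comment> \<open>Since the chart domain lies in \<open>N\<close>, cutting the curve down to
      \<open>N\<close> changes nothing on \<open>U\<close>, and this one chart serves every point of
      the piece.\<close>
    have "\<gamma> \<inter> N \<inter> U \<inter> U = \<gamma> \<inter> U" using c(3) by auto
    then have "submanifold1 real_analytic_on (\<gamma> \<inter> N \<inter> U)"
      unfolding submanifold1_def using c by (intro ballI exI[of _ U] exI[of _ V] exI[of _ \<phi>] exI[of _ \<psi>]) auto
    then show "\<exists>U. open U \<and> p \<in> U \<and> submanifold1 real_analytic_on (\<gamma> \<inter> N \<inter> U)"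
      using c(1,2) by blast
  qed
  then show ?thesis unfolding germ_real_analytic_off_0_def using N by blast
qed

text \<open>Re (1 / y) has modulus |Re y| / |y|^2, and |Re y| >= |y| / 2 for a nearly real y.
  Applied to y = a q^k, it sends the curve far to the left or right in the Fatou coordinate.\<close>

lemma abs_Re_inverse_ge:
  assumes "y \<noteq> 0" "\<bar>Im y\<bar> \<le> norm y / 2"
  shows "\<bar>Re (1 / y)\<bar> \<ge> 1 / (2 * norm y)"
proof -
  have "norm y \<le> \<bar>Re y\<bar> + \<bar>Im y\<bar>" by (rule cmod_le)
  then have "\<bar>Re y\<bar> \<ge> norm y / 2" using assms(2) by linarith
  then have "\<bar>Re y\<bar> / (norm y)\<^sup>2 \<ge> (norm y / 2) / (norm y)\<^sup>2"
    by (intro divide_right_mono) auto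
  moreover have "\<bar>Re (1 / y)\<bar> = \<bar>Re y\<bar> / (norm y)\<^sup>2"
    by (simp add: Re_divide cmod_power2)
  ultimately show ?thesis
    using assms(1) by (simp add: power2_eq_square)
qed

text \<open>Separates the two uses of the C^1 hypothesis: topological charts all along the curve,
  and a common direction of chords near 0. The tangent line at 0 is Im (w * h) = 0.\<close>

locale tangent_curve =
  fixes \<gamma> :: "complex set" and w :: complex
  assumes zero_in_curve: "0 \<in> \<gamma>"
    and charts: "\<And>q. q \<in> \<gamma> \<Longrightarrow> \<exists>\<phi> \<psi> U V. straightens \<phi> \<psi> U V \<gamma> \<and> q \<in> U"
    and w_nonzero: "w \<noteq> 0"
    and chord: "\<And>\<epsilon>. \<epsilon> > 0 \<Longrightarrow> \<exists>\<delta>>0. \<forall>a\<in>\<gamma> \<inter> ball 0 \<delta>. \<forall>b\<in>\<gamma> \<inter> ball 0 \<delta>.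
       \<bar>Im (w * (a - b))\<bar> \<le> \<epsilon> * norm (w * (a - b))"
begin

section \<open>Germs preserving a curve with a tangent at the origin\<close>

definition invariant :: "(complex \<Rightarrow> complex) \<Rightarrow> bool" where
  "invariant f \<longleftrightarrow> (\<forall>\<^sub>F q in nhds 0. q \<in> \<gamma> \<longrightarrow> f q \<in> \<gamma>)"

text \<open>\<open>\<rho>\<close> depends only on where \<open>g\<close> is univalent and respects
  the curve, so discs and petals can be constructed inside the ball afterwards.\<close>

lemma chart_of_contracted:
  assumes g: "g analytic_on {0}" "deriv g 0 \<noteq> 0" and inv: "invariant g"
  obtains \<rho> where "\<rho> > 0"
    "\<And>P q. open P \<Longrightarrow> P \<subseteq> ball 0 \<rho> \<Longrightarrow> g ` P \<subseteq> P \<Longrightarrow> (\<And>z. z \<in> P \<Longrightarrow> (\<lambda>n. (g ^^ n) z) \<longlonglongrightarrow> 0) \<Longrightarrow>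
       q \<in> \<gamma> \<Longrightarrow> q \<in> P \<Longrightarrow> holomorphic_chart_at \<gamma> q"
proof -
  obtain e where e: "e > 0" "g holomorphic_on ball 0 e"
    using g(1) by (auto simp: analytic_at_ball)
  have "0 \<in> ball (0::complex) e" using e(1) by simp
  from has_complex_derivative_locally_invertible[OF e(2) this open_ball g(2)]
  obtain r where r: "r > 0" "ball (0::complex) r \<subseteq> ball 0 e" "inj_on g (ball 0 r)"
    by metis
  obtain d where d: "d > 0" "\<And>q. norm q < d \<Longrightarrow> q \<in> \<gamma> \<Longrightarrow> g q \<in> \<gamma>"
    using inv unfolding invariant_def eventually_nhds_metric by (auto simp: dist_norm)
  show ?thesis
  proof (rule that[of "min r d"])
    show "min r d > 0" using r d by simp
    fix P q
    assume P: "open P" "P \<subseteq> ball 0 (min r d)" "g ` P \<subseteq> P" "\<And>z. z \<in> P \<Longrightarrow> (\<lambda>n. (g ^^ n) z) \<longlonglongrightarrow> 0"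
      and q: "q \<in> \<gamma>" "q \<in> P"
    obtain \<phi> \<psi> U V where st: "straightens \<phi> \<psi> U V \<gamma>" "q \<in> U" using charts[OF q(1)] by blast
    have Pr: "P \<subseteq> ball 0 r" using P(2) by force
    have "g holomorphic_on P" "inj_on g P"
      using e(2) r(2,3) Pr by (meson holomorphic_on_subset inj_on_subset order_trans)+
    moreover have "g z \<in> \<gamma>" if "z \<in> \<gamma> \<inter> P" for z
      using d(2)[of z] P(2) that by auto
    ultimately show "holomorphic_chart_at \<gamma> q"
      using contracted_curve_holomorphic_chart[OF P(1) _ _ P(3,4) _ chord w_nonzero st q] by blast
  qed
qed

text \<open>The point is that \<open>f\<close> maps the curve onto a neighbourhood of 0 in itself.
  In the chart at 0 its restriction to the curve is continuous, injective and real-valued, so the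
  image contains a full interval around \<open>\<phi> 0\<close>.\<close>

lemma invariant_inverse:
  assumes f: "f analytic_on {0}" "f 0 = 0" and inv: "invariant f"
    and h: "\<forall>\<^sub>F z in nhds 0. h (f z) = z"
  shows "invariant h"
proof -
  obtain \<phi> \<psi> U V where st: "straightens \<phi> \<psi> U V \<gamma>" "0 \<in> U" using charts[OF zero_in_curve] by blast
  have hom: "homeomorphism U V \<phi> \<psi>" and op: "open U" using st by (auto simp: straightens_def)
  have c\<phi>: "continuous_on U \<phi>" using hom by (simp add: homeomorphism_def)
  obtain e where e: "e > 0" "f holomorphic_on ball 0 e"
    using f(1) by (auto simp: analytic_at_ball)
  have cf: "continuous_on (ball 0 e) f" using e(2) by (rule holomorphic_on_imp_continuous_on)
  have "isCont f 0" using f(1) by (rule analytic_at_imp_isCont)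
  then have "(f \<longlongrightarrow> f 0) (nhds 0)"
    by (simp add: isCont_def tendsto_at_iff_tendsto_nhds)
  then have "\<forall>\<^sub>F z in nhds 0. f z \<in> U"
    using op st(2) f(2) by (intro topological_tendstoD) auto
  moreover have "\<forall>\<^sub>F z in nhds 0. z \<in> ball (0::complex) e"
    using e(1) by (intro eventually_nhds_in_open) auto
  ultimately have "\<forall>\<^sub>F z in nhds 0. f z \<in> U \<and> z \<in> ball 0 e \<and> h (f z) = z \<and> (z \<in> \<gamma> \<longrightarrow> f z \<in> \<gamma>)"
    using h inv unfolding invariant_def by eventually_elim simp
  then obtain B where B: "open B" "0 \<in> B"
    "\<And>z. z \<in> B \<Longrightarrow> f z \<in> U \<and> z \<in> ball 0 e \<and> h (f z) = z \<and> (z \<in> \<gamma> \<longrightarrow> f z \<in> \<gamma>)"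
    unfolding eventually_nhds by blast
  obtain \<delta> where \<delta>: "\<delta> > 0" "\<And>t. Im t = 0 \<Longrightarrow> norm (t - \<phi> (f 0)) < \<delta> \<Longrightarrow> t \<in> (\<lambda>z. \<phi> (f z)) ` (\<gamma> \<inter> B)"
  proof (rule straightens_real_nbhd[OF st zero_in_curve B(1,2), of "\<lambda>z. \<phi> (f z)"])
    show "continuous_on (\<gamma> \<inter> B) (\<lambda>z. \<phi> (f z))"
      by (intro continuous_on_compose2[OF c\<phi>] continuous_on_subset[OF cf]) (use B(3) in auto)
    show "inj_on (\<lambda>z. \<phi> (f z)) (\<gamma> \<inter> B)"
      by (rule inj_on_inverseI[of _ "\<lambda>v. h (\<psi> v)"]) (use B(3) homeomorphism_apply1[OF hom] in auto)
    show "Im (\<phi> (f z)) = 0" if "z \<in> \<gamma> \<inter> B" for z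
      using that B(3)[of z] straightens_iff[OF st(1)] by auto
  qed auto
  have "isCont \<phi> 0" using c\<phi> op st(2) by (simp add: continuous_on_eq_continuous_at)
  then have "(\<phi> \<longlongrightarrow> \<phi> 0) (nhds 0)"
    by (simp add: isCont_def tendsto_at_iff_tendsto_nhds)
  then have "\<forall>\<^sub>F q in nhds 0. dist (\<phi> q) (\<phi> 0) < \<delta>" using \<delta>(1) by (rule tendstoD)
  moreover have "\<forall>\<^sub>F q in nhds 0. q \<in> U" using op st(2) by (rule eventually_nhds_in_open)
  ultimately show ?thesis
    unfolding invariant_def
  proof eventually_elim
    case (elim q)
    show ?case
    proof
      assume "q \<in> \<gamma>"
      then have "Im (\<phi> q) = 0" using straightens_iff[OF st(1)] elim(2) by blast
      then have "\<phi> q \<in> (\<lambda>z. \<phi> (f z)) ` (\<gamma> \<inter> B)"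
        using \<delta>(2)[of "\<phi> q"] elim(1) f(2) by (simp add: dist_norm)
      then obtain z where z: "z \<in> \<gamma>" "z \<in> B" "\<phi> q = \<phi> (f z)" by blast
      then have "q = f z"
        using homeomorphism_apply1[OF hom] B(3)[of z] elim(2) by metis
      then show "h q \<in> \<gamma>" using z B(3)[of z] by simp
    qed
  qed
qed

text \<open>A number \<open>c\<close> strictly between the modulus of the multiplier and 1 is a
  contraction factor on a small disc, which then serves as the contracted set for all curve points
  near 0.\<close>

lemma charts_of_hyperbolic:
  assumes g: "g analytic_on {0}" "g 0 = 0" "deriv g 0 \<noteq> 0" "norm (deriv g 0) < 1" and inv: "invariant g"
  shows "\<forall>\<^sub>F q in at 0. q \<in> \<gamma> \<longrightarrow> holomorphic_chart_at \<gamma> q"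
proof -
  obtain \<rho> where \<rho>: "\<rho> > 0"
    "\<And>P q. open P \<Longrightarrow> P \<subseteq> ball 0 \<rho> \<Longrightarrow> g ` P \<subseteq> P \<Longrightarrow> (\<And>z. z \<in> P \<Longrightarrow> (\<lambda>n. (g ^^ n) z) \<longlonglongrightarrow> 0) \<Longrightarrow>
       q \<in> \<gamma> \<Longrightarrow> q \<in> P \<Longrightarrow> holomorphic_chart_at \<gamma> q"
    using chart_of_contracted[OF g(1,3) inv] by blast
  obtain c where c: "norm (deriv g 0) < c" "c < 1" using dense[OF g(4)] by blast
  have c0: "0 \<le> c" using c(1) norm_ge_zero[of "deriv g 0"] by linarith
  have "(g has_field_derivative deriv g 0) (at 0)"
    using g by (metis DERIV_deriv_iff_field_differentiable analytic_on_imp_differentiable_at singletonI)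
  then have "((\<lambda>z. norm (g z / z)) \<longlongrightarrow> norm (deriv g 0)) (at 0)"
    using g(2) by (intro tendsto_norm) (simp add: DERIV_def)
  then have "\<forall>\<^sub>F z in at 0. norm (g z / z) < c" using c(1) by (rule order_tendstoD)
  then obtain d where d: "d > 0" "\<And>z. z \<noteq> 0 \<Longrightarrow> norm z < d \<Longrightarrow> norm (g z / z) < c"
    unfolding eventually_at by (auto simp: dist_norm)
  have contr: "norm (g z) \<le> c * norm z" if "norm z < d" for z
    using d(2)[of z] that g(2) c0 by (cases "z = 0") (auto simp: norm_divide divide_less_eq)
  define P where "P = ball (0::complex) (min \<rho> d)"
  have gP: "g z \<in> P" if "z \<in> P" for z
  proof -
    have "c * norm z \<le> norm z" using c(2) c0 by (simp add: mult_left_le_one_le)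
    then show ?thesis using contr[of z] that by (auto simp: P_def)
  qed
  have lim: "(\<lambda>n. (g ^^ n) z) \<longlonglongrightarrow> 0" if "z \<in> P" for z
  proof -
    have bound: "(g ^^ n) z \<in> P \<and> norm ((g ^^ n) z) \<le> c ^ n * norm z" for n
    proof (induction n)
      case (Suc n)
      have "norm ((g ^^ Suc n) z) \<le> c * norm ((g ^^ n) z)"
        using contr[of "(g ^^ n) z"] Suc by (simp add: P_def)
      also have "\<dots> \<le> c * (c ^ n * norm z)" using Suc c0 by (intro mult_left_mono) auto
      finally show ?case using Suc gP by simp
    qed (use that in simp)
    have "(\<lambda>n. c ^ n * norm z) \<longlonglongrightarrow> 0 * norm z"
      using c(2) c0 by (intro tendsto_intros LIMSEQ_power_zero) simp
    then have "(\<lambda>n. c ^ n * norm z) \<longlonglongrightarrow> 0" by simp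
    moreover have "\<forall>\<^sub>F n in sequentially. norm ((g ^^ n) z) \<le> c ^ n * norm z"
      using bound by (intro always_eventually) blast
    ultimately show ?thesis by (rule Lim_null_comparison[rotated])
  qed
  have "\<forall>\<^sub>F q in at 0. q \<in> P"
    using \<rho>(1) d(1) by (intro eventually_at_in_open') (auto simp: P_def)
  then show ?thesis
  proof eventually_elim
    case (elim q)
    have "open P" "P \<subseteq> ball 0 \<rho>" "g ` P \<subseteq> P" using gP by (auto simp: P_def)
    then show ?case using \<rho>(2) lim elim by blast
  qed
qed

text \<open>As 0, q and g q all lie on the curve, the numbers q, g q and g q - q are chords of it
  near 0, and their quotients are nearly real.\<close>

lemma chord_quotient_eventually:
  assumes g: "(g \<longlongrightarrow> 0) (at 0)" and inv: "invariant g" and "\<epsilon> > 0"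
  shows "\<forall>\<^sub>F q in at 0. q \<in> \<gamma> \<longrightarrow> \<bar>Im (g q / q)\<bar> \<le> \<epsilon> * norm (g q / q) \<and>
    \<bar>Im ((g q - q) / q)\<bar> \<le> \<epsilon> * norm ((g q - q) / q)"
proof -
  \<comment> \<open>The tolerance is halved because \<open>Im_divide_le\<close> doubles it.\<close>
  obtain \<delta> where \<delta>: "\<delta> > 0" "\<forall>a\<in>\<gamma> \<inter> ball 0 \<delta>. \<forall>b\<in>\<gamma> \<inter> ball 0 \<delta>.
         \<bar>Im (w * (a - b))\<bar> \<le> \<epsilon> / 2 * norm (w * (a - b))"
    using chord[of "\<epsilon> / 2"] assms(3) by auto
  have quot: "\<bar>Im ((a - b) / (c - 0))\<bar> \<le> \<epsilon> * norm ((a - b) / (c - 0))"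
    if "a \<in> \<gamma> \<inter> ball 0 \<delta>" "b \<in> \<gamma> \<inter> ball 0 \<delta>" "c \<in> \<gamma> \<inter> ball 0 \<delta>" for a b c
  proof -
    have "0 \<in> \<gamma> \<inter> ball 0 \<delta>" using zero_in_curve \<delta>(1) by simp
    then have "\<bar>Im (w * (a - b))\<bar> \<le> \<epsilon> / 2 * norm (w * (a - b))"
      "\<bar>Im (w * (c - 0))\<bar> \<le> \<epsilon> / 2 * norm (w * (c - 0))"
      using \<delta>(2) that by blast+
    from Im_divide_le[OF this] show ?thesis using w_nonzero by simp
  qed
  have "\<forall>\<^sub>F q in at 0. q \<in> \<gamma> \<longrightarrow> g q \<in> \<gamma>"
    using inv unfolding invariant_def eventually_at_filter by eventually_elim simp
  moreover have "\<forall>\<^sub>F q in at 0. g q \<in> ball 0 \<delta>"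
    using g \<delta>(1) by (intro topological_tendstoD) auto
  moreover have "\<forall>\<^sub>F q in at 0. q \<in> ball (0::complex) \<delta>"
    using \<delta>(1) by (intro eventually_at_in_open') auto
  ultimately show ?thesis
  proof eventually_elim
    case (elim q)
    then show ?case
      using quot[of "g q" 0 q] quot[of "g q" q q] zero_in_curve \<delta>(1) by simp
  qed
qed

text \<open>Along the curve g q / q tends to the multiplier and is asymptotically real; 0 is a limit
  point of the curve, so the inequality passes to the limit.\<close>

lemma invariant_multiplier_real:
  assumes g: "g analytic_on {0}" "g 0 = 0" and inv: "invariant g"
  shows "Im (deriv g 0) = 0"
proof -
  have "(g has_field_derivative deriv g 0) (at 0)"
    using g by (metis DERIV_deriv_iff_field_differentiable analytic_on_imp_differentiable_at singletonI)
  then have "((\<lambda>z. g z / z) \<longlongrightarrow> deriv g 0) (at 0)"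
    using g(2) by (simp add: DERIV_def)
  then have lim: "((\<lambda>z. g z / z) \<longlongrightarrow> deriv g 0) (at 0 within \<gamma>)"
    by (rule tendsto_within_subset) simp
  have "(g \<longlongrightarrow> 0) (at 0)"
    using analytic_at_imp_isCont[OF g(1)] g(2) by (simp add: isCont_def)
  note ev = chord_quotient_eventually[OF this inv]
  obtain \<phi> \<psi> U V where st: "straightens \<phi> \<psi> U V \<gamma>" "0 \<in> U" using charts[OF zero_in_curve] by blast
  have nt: "at 0 within \<gamma> \<noteq> bot"
    using straightens_islimpt[OF st zero_in_curve] by (simp add: trivial_limit_within)
  have *: "\<bar>Im (deriv g 0)\<bar> \<le> \<epsilon> * norm (deriv g 0)" if "\<epsilon> > 0" for \<epsilon>
  proof (rule tendsto_le[OF nt])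
    show "((\<lambda>z. \<epsilon> * norm (g z / z)) \<longlongrightarrow> \<epsilon> * norm (deriv g 0)) (at 0 within \<gamma>)"
      by (intro tendsto_intros lim)
    show "((\<lambda>z. \<bar>Im (g z / z)\<bar>) \<longlongrightarrow> \<bar>Im (deriv g 0)\<bar>) (at 0 within \<gamma>)"
      by (intro tendsto_intros lim)
    show "\<forall>\<^sub>F z in at 0 within \<gamma>. \<bar>Im (g z / z)\<bar> \<le> \<epsilon> * norm (g z / z)"
      using ev[OF that] unfolding eventually_at_filter by eventually_elim simp
  qed
  show ?thesis
  proof (rule ccontr)
    assume "Im (deriv g 0) \<noteq> 0"
    then have "norm (deriv g 0) > 0" "\<bar>Im (deriv g 0)\<bar> > 0" by auto
    then show False using *[of "\<bar>Im (deriv g 0)\<bar> / (2 * norm (deriv g 0))"] by simp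
  qed
qed

text \<open>The chords from \<open>q\<close> to \<open>g q\<close> and from \<open>0\<close> to \<open>q\<close> are both nearly tangent to the curve and their
  quotient is asymptotic to \<open>a q\<^sup>k\<close>, so \<open>a q\<^sup>k\<close> is nearly real.\<close>

lemma fatou_coordinate_real_part_large:
  fixes a :: complex
  assumes g: "(g \<longlongrightarrow> 0) (at 0)" and inv: "invariant g" and a: "a \<noteq> 0" and k: "k \<ge> 1"
    and lim: "((\<lambda>z. (g z - z) / z ^ Suc k) \<longlongrightarrow> a) (at 0)"
  shows "\<forall>\<^sub>F q in at 0. q \<in> \<gamma> \<longrightarrow> \<bar>Re (1 / (a * q ^ k))\<bar> > R"
proof -
  have "((\<lambda>z. (g z - z) / z ^ Suc k / a) \<longlongrightarrow> a / a) (at 0)"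
    by (intro tendsto_intros lim a)
  then have "((\<lambda>z. (g z - z) / z ^ Suc k / a) \<longlongrightarrow> 1) (at 0)" using a by simp
  then have u: "\<forall>\<^sub>F z in at 0. dist ((g z - z) / z ^ Suc k / a) 1 < 1 / 8" by (rule tendstoD) simp
  have "((\<lambda>z. a * z ^ k) \<longlongrightarrow> a * 0 ^ k) (at 0)" by (intro tendsto_intros)
  then have "((\<lambda>z. a * z ^ k) \<longlongrightarrow> 0) (at 0)" using k by (simp add: power_0_left)
  \<comment> \<open>This bound on y = a q^k makes 1 / (2 * norm y) exceed |R| + 1.\<close>
  then have small: "\<forall>\<^sub>F z in at 0. dist (a * z ^ k) 0 < 1 / (2 * (\<bar>R\<bar> + 1))" by (rule tendstoD) simp
  \<comment> \<open>The tolerances 1/4 and 1/8 combine to 1/4 * 9/8 + 1/8 = 13/32, below the 1/2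
    that \<open>abs_Re_inverse_ge\<close> allows.\<close>
  have "(1/4 :: real) > 0" by simp
  from u small chord_quotient_eventually[OF g inv this] eventually_neq_at_within[of 0 0]
  show ?thesis
  proof eventually_elim
    case (elim q)
    show ?case
    proof
      assume q: "q \<in> \<gamma>"
      define y where "y = a * q ^ k"
      define x where "x = (g q - q) / q ^ Suc k / a"
      have y: "y \<noteq> 0" using a elim(4) by (simp add: y_def)
      have "(g q - q) / q = y * x" using a elim(4) by (simp add: x_def y_def)
      then have yx: "\<bar>Im (y * x)\<bar> \<le> 1/4 * norm (y * x)" using elim(3) q by auto
      have x1: "norm (x - 1) \<le> 1/8" using elim(1) by (simp add: x_def dist_norm)
      then have xn: "norm x \<le> 9/8" using norm_triangle_ineq[of "x - 1" 1] by simp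
      have "Im y = Im (y * x) - Im (y * (x - 1))" by (simp add: algebra_simps)
      then have "\<bar>Im y\<bar> \<le> \<bar>Im (y * x)\<bar> + norm (y * (x - 1))"
        using abs_Im_le_cmod[of "y * (x - 1)"] by linarith
      also have "\<dots> \<le> 1/4 * (norm y * (9/8)) + norm y * (1/8)"
        using yx mult_left_mono[OF xn, of "norm y"] mult_left_mono[OF x1, of "norm y"]
        by (simp add: norm_mult)
      also have "\<dots> \<le> norm y / 2" by simp
      finally have "1 / (2 * norm y) \<le> \<bar>Re (1 / y)\<bar>" by (rule abs_Re_inverse_ge[OF y])
      moreover have "norm y < 1 / (2 * (\<bar>R\<bar> + 1))" using elim(2) by (simp add: y_def dist_norm)
      then have "\<bar>R\<bar> + 1 < 1 / (2 * norm y)" using y by (simp add: field_simps)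
      ultimately show "\<bar>Re (1 / (a * q ^ k))\<bar> > R" unfolding y_def by linarith
    qed
  qed
qed

text \<open>On the curve -1 / (a q^k) has real part of large modulus. Where it is positive, q lies
  in the attracting petals of \<open>g\<close>; where it is negative, in those of the inverse
  \<open>h\<close>, which has coefficient \<open>- a\<close> and also preserves the curve.\<close>

lemma charts_of_parabolic:
  assumes g: "g analytic_on {0}" "g 0 = 0" "deriv g 0 = 1" and ne: "\<not> (\<forall>\<^sub>F z in nhds 0. g z = z)"
    and inv: "invariant g"
  shows "\<forall>\<^sub>F q in at 0. q \<in> \<gamma> \<longrightarrow> holomorphic_chart_at \<gamma> q"
proof -
  obtain a k where a: "a \<noteq> 0" and k: "k \<ge> 1" and lim: "((\<lambda>z. (g z - z) / z ^ Suc k) \<longlongrightarrow> a) (at 0)"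
    using parabolic_tangency_coefficient[OF g ne] by blast
  have g1: "deriv g 0 \<noteq> 0" using g(3) by simp
  obtain h where h: "h analytic_on {0}" "h 0 = 0" "deriv g 0 * deriv h 0 = 1"
    "\<forall>\<^sub>F z in nhds 0. h (g z) = z" "\<forall>\<^sub>F z in nhds 0. g (h z) = z"
    using analytic_local_inverse[OF g(1,2) g1] by blast
  have dh: "deriv h 0 = 1" using h(3) g(3) by simp
  then have "(h has_field_derivative 1) (at 0)"
    using h(1) by (metis DERIV_deriv_iff_field_differentiable analytic_on_imp_differentiable_at singletonI)
  from tangency_coefficient_inverse[OF lim g(2) this h(2,5)]
  have limh: "((\<lambda>z. (h z - z) / z ^ Suc k) \<longlongrightarrow> - a) (at 0)" .
  have invh: "invariant h" by (rule invariant_inverse[OF g(1,2) inv h(4)])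
  obtain \<rho> where \<rho>: "\<rho> > 0"
    "\<And>P q. open P \<Longrightarrow> P \<subseteq> ball 0 \<rho> \<Longrightarrow> g ` P \<subseteq> P \<Longrightarrow> (\<And>z. z \<in> P \<Longrightarrow> (\<lambda>n. (g ^^ n) z) \<longlonglongrightarrow> 0) \<Longrightarrow>
       q \<in> \<gamma> \<Longrightarrow> q \<in> P \<Longrightarrow> holomorphic_chart_at \<gamma> q"
    using chart_of_contracted[OF g(1) g1 inv] by blast
  have h1: "deriv h 0 \<noteq> 0" using dh by simp
  obtain \<rho>' where \<rho>': "\<rho>' > 0"
    "\<And>P q. open P \<Longrightarrow> P \<subseteq> ball 0 \<rho>' \<Longrightarrow> h ` P \<subseteq> P \<Longrightarrow> (\<And>z. z \<in> P \<Longrightarrow> (\<lambda>n. (h ^^ n) z) \<longlonglongrightarrow> 0) \<Longrightarrow>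
       q \<in> \<gamma> \<Longrightarrow> q \<in> P \<Longrightarrow> holomorphic_chart_at \<gamma> q"
    using chart_of_contracted[OF h(1) h1 invh] by blast
  obtain R P where P: "open P" "P \<subseteq> ball 0 \<rho>" "g ` P \<subseteq> P" "\<And>z. z \<in> P \<Longrightarrow> (\<lambda>n. (g ^^ n) z) \<longlonglongrightarrow> 0"
    "\<And>z. z \<noteq> 0 \<Longrightarrow> Re (- 1 / (a * z ^ k)) > R \<Longrightarrow> z \<in> P"
    by (rule attracting_petals[OF a k lim \<rho>(1)]) (rule that)
  have a': "- a \<noteq> 0" using a by simp
  obtain R' P' where P': "open P'" "P' \<subseteq> ball 0 \<rho>'" "h ` P' \<subseteq> P'" "\<And>z. z \<in> P' \<Longrightarrow> (\<lambda>n. (h ^^ n) z) \<longlonglongrightarrow> 0"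
    "\<And>z. z \<noteq> 0 \<Longrightarrow> Re (- 1 / (- a * z ^ k)) > R' \<Longrightarrow> z \<in> P'"
    by (rule attracting_petals[OF a' k limh \<rho>'(1)]) (rule that)
  have "(g \<longlongrightarrow> 0) (at 0)"
    using analytic_at_imp_isCont[OF g(1)] g(2) by (simp add: isCont_def)
  from fatou_coordinate_real_part_large[OF this inv a k lim, of "max R R'"] eventually_neq_at_within[of 0 0]
  show ?thesis
  proof eventually_elim
    case (elim q)
    show ?case
    proof
      assume q: "q \<in> \<gamma>"
      then have "Re (- 1 / (a * q ^ k)) > R \<or> Re (- 1 / (- a * q ^ k)) > R'"
        using elim(1) by auto
      then have "q \<in> P \<or> q \<in> P'" using P(5) P'(5) elim(2) by blast
      then show "holomorphic_chart_at \<gamma> q"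
        using \<rho>(2)[OF P(1-4) q] \<rho>'(2)[OF P'(1-4) q] by blast
    qed
  qed
qed

text \<open>An expanding germ is replaced by its inverse. A multiplier of modulus 1 is real, so its
  square is 1 and f o f is tangent to the identity; it differs from the identity because f is not an
  involution.\<close>

lemma charts_of_invariant:
  assumes f: "f analytic_on {0}" "f 0 = 0" "deriv f 0 \<noteq> 0" and inv: "invariant f"
    and ne: "\<not> (\<forall>\<^sub>F z in nhds 0. f (f z) = z)"
  shows "\<forall>\<^sub>F q in at 0. q \<in> \<gamma> \<longrightarrow> holomorphic_chart_at \<gamma> q"
proof -
  consider "norm (deriv f 0) < 1" | "norm (deriv f 0) > 1" | "norm (deriv f 0) = 1" by linarith
  then show ?thesis
  proof cases
    case 1
    then show ?thesis using charts_of_hyperbolic[OF f _ inv] by blast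
  next
    case 2
    obtain h where h: "h analytic_on {0}" "h 0 = 0" "deriv f 0 * deriv h 0 = 1"
      "\<forall>\<^sub>F z in nhds 0. h (f z) = z"
      using analytic_local_inverse[OF f] by blast
    have "deriv h 0 = inverse (deriv f 0)" using inverse_unique[OF h(3)] by simp
    then have "norm (deriv h 0) < 1" using 2 by (simp add: norm_inverse inverse_less_1_iff)
    moreover have "deriv h 0 \<noteq> 0" using h(3) by auto
    ultimately show ?thesis
      using charts_of_hyperbolic[OF h(1,2)] invariant_inverse[OF f(1,2) inv h(4)] by blast
  next
    case 3
    have "deriv f 0 = of_real (Re (deriv f 0))"
      using invariant_multiplier_real[OF f(1,2) inv] by (simp add: complex_eq_iff)
    then have "deriv f 0 * deriv f 0 = 1"
      using 3 by (metis abs_mult_self_eq norm_of_real of_real_1 of_real_mult mult_1)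
    moreover have "deriv (f \<circ> f) 0 = deriv f (f 0) * deriv f 0"
      by (rule deriv_chain) (use f in \<open>auto intro: analytic_on_imp_differentiable_at\<close>)
    ultimately have d: "deriv (f \<circ> f) 0 = 1" using f(2) by simp
    have an: "(f \<circ> f) analytic_on {0}" using f by (intro analytic_on_compose) auto
    have "filterlim f (nhds (f 0)) (nhds 0)"
      using analytic_at_imp_isCont[OF f(1)] by (simp add: isCont_def tendsto_at_iff_tendsto_nhds)
    then have "filterlim f (nhds 0) (nhds 0)" using f(2) by simp
    from eventually_compose_filterlim[OF inv[unfolded invariant_def] this] inv[unfolded invariant_def]
    have "invariant (f \<circ> f)"
      unfolding invariant_def by eventually_elim simp
    then show ?thesis
      using charts_of_parabolic[OF an _ d] f(2) ne by simp
  qed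
qed

end

section \<open>Return to germs and to curves of class C^1\<close>

lemma curve_around_0_tangent_curve:
  assumes "curve_around_0 1 \<gamma>"
  obtains w where "tangent_curve \<gamma> w"
proof -
  have zero: "0 \<in> \<gamma>" and sub: "submanifold1 (class_C_on 1) \<gamma>"
    using assms by (auto simp: curve_around_0_def)
  have charts: "\<exists>\<phi> \<psi> U V. straightens \<phi> \<psi> U V \<gamma> \<and> q \<in> U \<and> Ck_on 1 \<phi> U \<and> Ck_on 1 \<psi> V" if "q \<in> \<gamma>" for q
  proof -
    have "\<exists>U V \<phi> \<psi>. open U \<and> q \<in> U \<and> open V \<and> homeomorphism U V \<phi> \<psi> \<and>
        class_C_on 1 \<phi> U \<and> class_C_on 1 \<psi> V \<and> \<phi> ` (\<gamma> \<inter> U) = {w \<in> V. Im w = 0}"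
      using sub that by (simp add: submanifold1_def)
    then obtain U V \<phi> \<psi> where c: "open U" "q \<in> U" "open V" "homeomorphism U V \<phi> \<psi>"
      "class_C_on 1 \<phi> U" "class_C_on 1 \<psi> V" "\<phi> ` (\<gamma> \<inter> U) = {w \<in> V. Im w = 0}"
      by (elim exE conjE)
    have "straightens \<phi> \<psi> U V \<gamma>" using c by (simp add: straightens_def)
    moreover have "Ck_on 1 \<phi> U" "Ck_on 1 \<psi> V"
      using c(5,6) unfolding class_C_on_def one_enat_def by auto
    ultimately show ?thesis using c(2) by blast
  qed
  obtain \<phi> \<psi> U V where st: "straightens \<phi> \<psi> U V \<gamma>" "0 \<in> U" "Ck_on 1 \<phi> U" "Ck_on 1 \<psi> V"
    using charts[OF zero] by blast
  obtain w where "w \<noteq> 0"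
    "\<And>\<epsilon>. \<epsilon> > 0 \<Longrightarrow> \<exists>\<delta>>0. \<forall>a\<in>\<gamma> \<inter> ball 0 \<delta>. \<forall>b\<in>\<gamma> \<inter> ball 0 \<delta>.
       \<bar>Im (w * (a - b))\<bar> \<le> \<epsilon> * norm (w * (a - b))"
    using C1_chord_direction[OF st] by blast
  then have "tangent_curve \<gamma> w"
    using zero charts by unfold_locales blast+
  then show ?thesis by (rule that)
qed

lemma invariant_C1_curve_real_analytic:
  assumes "holomorphic_germ g" "germ_comp g g \<noteq> germ_id" "curve_around_0 1 \<gamma>" "invariant_curve g \<gamma>"
  shows "germ_real_analytic_off_0 \<gamma>"
proof -
  obtain w where "tangent_curve \<gamma> w" using curve_around_0_tangent_curve[OF assms(3)] by blast
  then interpret tangent_curve \<gamma> w .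
  have "\<forall>\<^sub>F q in at 0. q \<in> \<gamma> \<longrightarrow> holomorphic_chart_at \<gamma> q"
    using assms(1,2,4)
  proof (transfer fixing: \<gamma>)
    fix f assume r: "germ_rel f f" and f: "f analytic_on {0} \<and> deriv f 0 \<noteq> 0"
      and ne: "\<not> germ_rel (f \<circ> f) (\<lambda>z. z)" and inv: "\<forall>\<^sub>F q in nhds 0. q \<in> \<gamma> \<longrightarrow> f q \<in> \<gamma>"
    have f0: "f 0 = 0" and cf: "isCont f 0" using r by (auto simp: germ_rel_def)
    \<comment> \<open>Value and continuity at 0 are part of \<open>germ_rel\<close>; once they are
      settled for f o f, its failure can only be a failure of equality near 0.\<close>
    have "isCont (f \<circ> f) 0" using continuous_at_compose[of 0 f f] cf f0 by simp
    then have "\<not> (\<forall>\<^sub>F z in nhds 0. f (f z) = z)" using ne f0 by (auto simp: germ_rel_def)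
    then show "\<forall>\<^sub>F q in at 0. q \<in> \<gamma> \<longrightarrow> holomorphic_chart_at \<gamma> q"
      using charts_of_invariant f f0 inv unfolding invariant_def by blast
  qed
  then show ?thesis by (rule germ_real_analytic_off_0_if_charts)
qed

text \<open>(ICP) speaks of smooth curves; this lets the result for class C^1 cover them.\<close>

lemma curve_around_0_mono:
  assumes "curve_around_0 k \<gamma>" "l \<le> k"
  shows "curve_around_0 l \<gamma>"
proof -
  have "class_C_on l f U" if "class_C_on k f U" for f U
    using that assms(2) unfolding class_C_on_def by (meson order_trans)
  then show ?thesis
    using assms(1) unfolding curve_around_0_def submanifold1_def by meson
qed

theorem lemma1p4:
  shows "ICP Hol0 \<and>
    (\<forall>f\<in>Hol0. germ_comp f f \<noteq> germ_id \<longrightarrow>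
       (\<forall>\<gamma>. curve_around_0 1 \<gamma> \<longrightarrow> invariant_curve f \<gamma> \<longrightarrow> germ_real_analytic_off_0 \<gamma>))"
  using invariant_C1_curve_real_analytic subgroup_Hol0 curve_around_0_mono[of \<infinity> _ 1]
  unfolding ICP_def Hol0_def by auto

end
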